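(* Let $q$ be a complex number with $|q|<1$. Then the following four identities hold: \begin{align*} \sum_{i,j\geq 0}\frac{q^{(3i^2-i)/2+4ij+4j^2}}{(q;q)_{i}(q^4;q^4)_{j}}&=\frac{1}{(q,q^4,q^7;q^8)_\infty}, \\ \sum_{i,j\geq 0}\frac{q^{(3i^2+3i)/2+4ij+4j^2+4j}}{(q;q)_{i}(q^4;q^4)_{j}}&=\frac{1}{(q^3,q^4,q^5;q^8)_\infty}, \\ \sum_{i,j\geq 0}\frac{q^{(3i^2+i)/2+4ij+4j^2+2j}(1+q^{2i+4j+1})}{(q;q)_{i}(q^4;q^4)_{j}}&=\frac{1}{(q,q^5,q^6;q^8)_\infty}, \\ \sum_{i,j\geq 0}\frac{q^{(3i^2+i)/2+4ij+4j^2+2j}}{(q;q)_{i}(q^4;q^4)_{j}}&=\frac{1}{(q^2,q^3,q^7;q^8)_\infty}, \end{align*} where the sums run over all pairs of nonnegative integers $(i,j)$.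
   Context: Notation ($q$-Pochhammer symbols): for complex $a$ and a base $p$ with $|p|<1$, $(a;p)_0:=1$, $(a;p)_n:=\prod_{k=0}^{n-1}(1-ap^k)$ for integers $n\ge 1$, and $(a;p)_\infty:=\prod_{k=0}^{\infty}(1-ap^k)$. For several parameters, $(a_1,\dots,a_m;p)_\infty:=(a_1;p)_\infty\cdots(a_m;p)_\infty$. *)

theory Defs
  imports "HOL-Analysis.Analysis"
begin

definition qpoch :: "complex \<Rightarrow> complex \<Rightarrow> nat \<Rightarrow> complex" where
  "qpoch a p n = (\<Prod>k<n. 1 - a * p ^ k)"

text \<open>The infinite product converges, in the sense of \<^const>\<open>has_prod\<close>, whenever
  \<open>norm p < 1\<close>; for other \<open>p\<close> the value is not meaningful.\<close>

definition qpoch_inf :: "complex \<Rightarrow> complex \<Rightarrow> complex" where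
  "qpoch_inf a p = (\<Prod>k. 1 - a * p ^ k)"

definition qpochs_inf :: "complex list \<Rightarrow> complex \<Rightarrow> complex" where
  "qpochs_inf as p = (\<Prod>a\<leftarrow>as. qpoch_inf a p)"

end

theory Submission
  imports Defs "HOL-Library.Nat_Bijection"
begin

text \<open>
Put \<open>N = i + 2 j\<close>. In each of the four sums the exponent is \<open>f(N) + i (i - 1) / 2\<close> with
  \<open>f(N)\<close> one of \<open>N\<^sup>2\<close>, \<open>N\<^sup>2 + 2 N\<close>, \<open>N\<^sup>2 + N\<close>, and the extra factor of the third sum is
  \<open>1 + q^(2 N + 1)\<close>. So the inner sum over \<open>i + 2 j = N\<close> is always the same one, namely the
  coefficient of \<open>x^N\<close> in \<open>(-x;q)_\<infinity> / (x\<^sup>2;q\<^sup>4)_\<infinity>\<close>. Since \<open>(x\<^sup>2;q\<^sup>4)_\<infinity> = (x;q\<^sup>2)_\<infinity> (-x;q\<^sup>2)_\<infinity>\<close>, this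
  series equals \<open>(-x q;q\<^sup>2)_\<infinity> / (x;q\<^sup>2)_\<infinity>\<close>, and the q-binomial theorem gives the coefficient
  \<open>(-q;q\<^sup>2)_N / (q\<^sup>2;q\<^sup>2)_N\<close> (\<open>antidiagonal_sum\<close>). The terms decay like \<open>|q|^(i+j)\<close>, so the
  double sums converge absolutely and become four classical single sums
  (\<open>double_sum_eq_single_sum\<close>).

  The weights \<open>N\<^sup>2 + N\<close> give the two little Goellnitz identities. Both are instances of Lebesgue's
  identity (\<open>lebesgue_identity\<close>) in base \<open>q\<^sup>2\<close>, whose proof iterates a first-order
  \<open>q\<close>-difference equation in the free parameter.

  The weights \<open>N\<^sup>2\<close> and \<open>N\<^sup>2 + 2 N\<close> give the two Goellnitz-Gordon identities. They follow from
  Bailey's lemma in a form with finite sums only (\<open>bailey_lemma\<close>), which rests on the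
  \<open>q\<close>-Chu-Vandermonde sum. A finite form of the Jacobi triple product provides a Bailey pair
  (\<open>theta_bailey_pair\<close>) for every \<open>x, y\<close> with \<open>x y = p\<close>. For \<open>x = 1\<close> its \<open>\<beta>\<close>-side is
  \<open>1, 0, 0, \<dots>\<close>; one Bailey step turns this into \<open>\<beta>_n = 1 / (p;p)_n\<close>, and a second one, with
  \<open>p = q\<^sup>2\<close>, introduces the factor \<open>(-q;q\<^sup>2)_n\<close>. Letting the upper summation bound tend to infinity
  (Tannery's theorem) leaves a theta series (\<open>bailey_slater_sum\<close>), which the limit of the same
  Bailey pairs, the Jacobi triple product, evaluates as an infinite product. Splitting all
  products into residue classes modulo 8 gives the stated right-hand sides.
\<close>

section \<open>Finite q-Pochhammer symbols\<close>

lemma qpoch_0 [simp]: "qpoch a p 0 = 1"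
  by (simp add: qpoch_def)

lemma qpoch_Suc: "qpoch a p (Suc n) = qpoch a p n * (1 - a * p ^ n)"
  by (simp add: qpoch_def)

lemma qpoch_Suc_left: "qpoch a p (Suc n) = (1 - a) * qpoch (a * p) p n"
  by (simp add: qpoch_def prod.lessThan_Suc_shift mult.assoc del: prod.lessThan_Suc)

lemma qpoch_add: "qpoch a p (m + n) = qpoch a p m * qpoch (a * p ^ m) p n"
  by (induction n) (simp_all add: qpoch_Suc power_add mult_ac)

lemma one_minus_mult_power_nonzero:
  assumes "norm p < 1" "norm a < 1"
  shows "1 - a * p ^ k \<noteq> (0 :: complex)"
proof
  assume "1 - a * p ^ k = 0"
  then have "norm a * norm p ^ k = 1"
    by (metis eq_iff_diff_eq_0 norm_mult norm_one norm_power)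
  moreover have "norm a * norm p ^ k \<le> norm a * 1"
    using assms by (intro mult_left_mono power_le_one) auto
  ultimately show False
    using assms by simp
qed

lemma qpoch_nonzero: "norm p < 1 \<Longrightarrow> norm a < 1 \<Longrightarrow> qpoch a p n \<noteq> 0"
  unfolding qpoch_def using one_minus_mult_power_nonzero[of p a] by (simp add: prod_zero_iff del: right_minus_eq)

lemma norm_power_less_one: "norm (p :: complex) < 1 \<Longrightarrow> n > 0 \<Longrightarrow> norm (p ^ n) < 1"
  by (simp add: norm_power power_less_one_iff)

section \<open>The q-Chu-Vandermonde sum and Bailey's lemma\<close>

text \<open>The numerator of the \<open>q\<close>-Chu-Vandermonde sum. With \<open>e = c / b\<close> it equals
  \<open>(b;p)_n (-c/b)^n p^(n(n-1)/2)\<close>, the usual form; taking \<open>e\<close> as the parameter instead of \<open>b\<close>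
  makes the limit \<open>b \<rightarrow> \<infinity>\<close> the ordinary value \<open>e = 0\<close>.\<close>

definition vander_weight :: "complex \<Rightarrow> complex \<Rightarrow> complex \<Rightarrow> nat \<Rightarrow> complex" where
  "vander_weight p c e n = (\<Prod>k<n. p ^ k * (c * p ^ k - e))"

lemma vander_weight_0 [simp]: "vander_weight p c e 0 = 1"
  by (simp add: vander_weight_def)

lemma vander_weight_add:
  "vander_weight p c e (r + m) = vander_weight p c e r * vander_weight p (c * p ^ (2 * r)) (e * p ^ r) m"
proof (induction m)
  case (Suc m)
  have "p ^ (r + m) * (c * p ^ (r + m) - e) = p ^ m * (c * p ^ (2 * r) * p ^ m - e * p ^ r)"
    by (simp add: power_add power_mult power2_eq_square algebra_simps)
  then show ?case
    using Suc by (simp add: vander_weight_def mult_ac)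
qed (simp add: vander_weight_def)

lemma vander_weight_Suc_left:
  "vander_weight p c e (Suc m) = (c - e) * p ^ m * vander_weight p (c * p) e m"
proof (induction m)
  case (Suc m)
  have "vander_weight p c e (Suc (Suc m)) = vander_weight p c e (Suc m) * (p ^ Suc m * (c * p ^ Suc m - e))"
    by (simp add: vander_weight_def)
  then show ?case
    by (simp add: Suc) (simp add: vander_weight_def mult_ac)
qed (simp add: vander_weight_def)

text \<open>Multiply the sum for \<open>M + 1\<close> by
  \<open>1 - p^(M+1) = (1 - p^(M+1-m)) + p^(M+1-m) (1 - p^m)\<close>. The first part of each term is the term of
  the sum for \<open>M\<close>; the second part, with \<open>m\<close> lowered by one, is a multiple of the term of the sum
  for \<open>M\<close> with \<open>c p\<close> in place of \<open>c\<close>. The induction therefore needs \<open>c\<close> arbitrary.\<close>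

lemma q_chu_vandermonde:
  assumes "norm p < 1" "norm c < 1"
  shows "(\<Sum>m\<le>M. vander_weight p c e m / (qpoch p p (M - m) * qpoch p p m * qpoch c p m))
           = qpoch e p M / (qpoch p p M * qpoch c p M)"
  using assms(2)
proof (induction M arbitrary: c)
  case (Suc M)
  note [simp] = qpoch_nonzero[OF assms(1) assms(1)]
  let ?T = "\<lambda>c M m. vander_weight p c e m / (qpoch p p (M - m) * qpoch p p m * qpoch c p m)"
  have cp: "norm (c * p) < 1"
    using mult_left_le[of "norm p" "norm c"] Suc.prems assms(1) by (simp add: norm_mult)
  have nz: "qpoch c p m \<noteq> 0" "qpoch (c * p) p m \<noteq> 0" "1 - c \<noteq> 0" for m
    using qpoch_nonzero[OF assms(1)] Suc.prems cp one_minus_mult_power_nonzero[OF assms(1) Suc.prems, of 0] by auto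
  have pnz: "1 - p * p ^ k \<noteq> 0" for k
    by (rule one_minus_mult_power_nonzero[OF assms(1) assms(1)])
  have step: "(1 - p ^ Suc M) * ?T c (Suc M) m = (if m \<le> M then ?T c M m else 0)
       + (if m = 0 then 0 else (c - e) / (1 - c) * p ^ M * ?T (c * p) M (m - 1))"
    if m: "m \<le> Suc M" for m
  proof -
    define X where "X = vander_weight p c e m / (qpoch p p (Suc M - m) * qpoch p p m * qpoch c p m)"
    have "(1 - p ^ Suc M) = (1 - p ^ (Suc M - m)) + p ^ (Suc M - m) * (1 - p ^ m)"
      using m by (simp add: algebra_simps power_add[symmetric] del: power_Suc)
    then have "(1 - p ^ Suc M) * X = (1 - p ^ (Suc M - m)) * X + p ^ (Suc M - m) * (1 - p ^ m) * X"
      by (simp only: distrib_right)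
    moreover have "(1 - p ^ (Suc M - m)) * X = (if m \<le> M then ?T c M m else 0)"
    proof (cases "m \<le> M")
      case True
      then have "Suc M - m = Suc (M - m)" by simp
      then show ?thesis using True pnz[of "M - m"]
        by (simp add: X_def qpoch_Suc)
    qed (use m in \<open>auto simp: le_Suc_eq\<close>)
    moreover have "p ^ (Suc M - m) * (1 - p ^ m) * X =
       (if m = 0 then 0 else (c - e) / (1 - c) * p ^ M * ?T (c * p) M (m - 1))"
    proof (cases m)
      case (Suc k)
      then have "p ^ M = p ^ (M - k) * p ^ k" using m by (simp add: power_add[symmetric])
      moreover have "qpoch p p m = qpoch p p k * (1 - p ^ m)" by (simp add: Suc qpoch_Suc)
      moreover have "1 - p ^ m \<noteq> 0" using pnz[of k] by (simp add: Suc)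
      ultimately show ?thesis using nz
        by (simp add: X_def Suc vander_weight_Suc_left qpoch_Suc_left[of c] mult_ac)
    qed simp
    ultimately show ?thesis unfolding X_def by simp
  qed
  have "(1 - p ^ Suc M) * (\<Sum>m\<le>Suc M. ?T c (Suc M) m) =
     (\<Sum>m\<le>Suc M. (if m \<le> M then ?T c M m else 0))
      + (\<Sum>m\<le>Suc M. (if m = 0 then 0 else (c - e) / (1 - c) * p ^ M * ?T (c * p) M (m - 1)))"
    unfolding sum_distrib_left sum.distrib[symmetric] by (intro sum.cong refl step) simp
  also have "(\<Sum>m\<le>Suc M. (if m \<le> M then ?T c M m else 0)) = (\<Sum>m\<le>M. ?T c M m)"
    by simp
  also have "(\<Sum>m\<le>Suc M. (if m = 0 then 0 else (c - e) / (1 - c) * p ^ M * ?T (c * p) M (m - 1)))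
     = (c - e) / (1 - c) * p ^ M * (\<Sum>m\<le>M. ?T (c * p) M m)"
    unfolding sum.atMost_Suc_shift sum_distrib_left by simp
  finally have "(1 - p ^ Suc M) * (\<Sum>m\<le>Suc M. ?T c (Suc M) m)
     = qpoch e p M / (qpoch p p M * qpoch c p M)
       + (c - e) / (1 - c) * p ^ M * (qpoch e p M / (qpoch p p M * qpoch (c * p) p M))"
    using Suc.IH[OF Suc.prems] Suc.IH[OF cp] by simp
  also have "\<dots> = (1 - p ^ Suc M) * (qpoch e p (Suc M) / (qpoch p p (Suc M) * qpoch c p (Suc M)))"
  proof -
    have a: "qpoch c p M * (1 - c * p ^ M) = (1 - c) * qpoch (c * p) p M"
      using qpoch_Suc[of c p M] qpoch_Suc_left[of c p M] by simp
    have "1 - c * p ^ M \<noteq> 0" by (rule one_minus_mult_power_nonzero[OF assms(1) Suc.prems])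
    then have b: "1 / qpoch c p M = (1 - c * p ^ M) / ((1 - c) * qpoch (c * p) p M)"
      using nz unfolding a[symmetric] by simp
    define K where "K = qpoch e p M / (qpoch p p M * ((1 - c) * qpoch (c * p) p M))"
    have "qpoch e p M / (qpoch p p M * qpoch c p M) = qpoch e p M / qpoch p p M * (1 / qpoch c p M)"
      by simp
    also have "\<dots> = (1 - c * p ^ M) * K"
      by (simp add: b K_def)
    finally have 1: "qpoch e p M / (qpoch p p M * qpoch c p M) = (1 - c * p ^ M) * K" .
    have 2: "(c - e) / (1 - c) * p ^ M * (qpoch e p M / (qpoch p p M * qpoch (c * p) p M))
               = (c - e) * p ^ M * K"
      by (simp add: K_def)
    have "(1 - p ^ Suc M) * (qpoch e p (Suc M) / (qpoch p p (Suc M) * qpoch c p (Suc M)))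
            = (1 - e * p ^ M) * K"
      using pnz[of M] by (simp add: K_def qpoch_Suc[of e] qpoch_Suc[of p] qpoch_Suc_left[of c])
    then show ?thesis
      unfolding 1 2 by (simp add: algebra_simps)
  qed
  finally show ?case
    using pnz[of M] by (subst (asm) mult_left_cancel) (simp_all del: sum.atMost_Suc)
qed simp

text \<open>Bailey pairs relative to \<open>a = p^s\<close>. The second denominator is \<open>(p;p)_(n+r+s)\<close> instead of the customary
  \<open>(a p;p)_(n+r)\<close>; this only rescales \<open>\<alpha>\<close> by the constant \<open>(p;p)_s\<close> and puts the two cases
  \<open>s = 0\<close>, \<open>s = 1\<close> on the same footing.\<close>

definition bailey_pair :: "complex \<Rightarrow> nat \<Rightarrow> (nat \<Rightarrow> complex) \<Rightarrow> (nat \<Rightarrow> complex) \<Rightarrow> bool" where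
  "bailey_pair p s \<alpha> \<beta> \<longleftrightarrow>
     (\<forall>n. \<beta> n = (\<Sum>r\<le>n. \<alpha> r / (qpoch p p (n - r) * qpoch p p (n + r + s))))"

text \<open>Insert the definition of \<open>\<beta>\<close> and interchange the two finite sums. For fixed \<open>r\<close> the sum over
  \<open>n = r + m\<close> is a \<open>q\<close>-Chu-Vandermonde sum with \<open>c = p^(2 r + s + 1)\<close>, because
  \<open>(p;p)_(n+r+s) = (p;p)_(2r+s) (c;p)_m\<close> and \<open>vander_weight_add\<close> splits the weight at \<open>r\<close>.\<close>

lemma bailey_lemma:
  assumes p: "norm p < 1" and w: "norm w < 1" and bp: "bailey_pair p s \<alpha> \<beta>"
  defines "\<delta> \<equiv> vander_weight p (p ^ Suc s) w"
  shows "bailey_pair p s (\<lambda>r. \<delta> r / qpoch w p r * \<alpha> r)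
           (\<lambda>L. (\<Sum>n\<le>L. \<delta> n * \<beta> n / qpoch p p (L - n)) / qpoch w p L)"
  unfolding bailey_pair_def
proof
  fix L
  note [simp] = qpoch_nonzero[OF p p] qpoch_nonzero[OF p w]
  let ?P = "qpoch p p"
  have inner: "(\<Sum>n\<in>{r..L}. \<delta> n / (?P (L - n) * ?P (n - r) * ?P (n + r + s)))
      = \<delta> r * (qpoch w p L / qpoch w p r) / (?P (L - r) * ?P (L + r + s))" if r: "r \<le> L" for r
  proof -
    define c where "c = p ^ Suc (2 * r + s)"
    have c: "norm c < 1" unfolding c_def by (intro norm_power_less_one p) simp
    have P: "?P (m + r + r + s) = ?P (2 * r + s) * qpoch c p m" for m
    proof -
      have "m + r + r + s = 2 * r + s + m" by simp
      then show ?thesis by (simp only: qpoch_add c_def power_Suc)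
    qed
    have d: "\<delta> (m + r) = \<delta> r * vander_weight p c (w * p ^ r) m" for m
      unfolding \<delta>_def using vander_weight_add[of p "p ^ Suc s" w r m]
      by (simp add: c_def add.commute power_add mult_ac)
    have "(\<Sum>n\<in>{r..L}. \<delta> n / (?P (L - n) * ?P (n - r) * ?P (n + r + s)))
       = (\<Sum>m\<le>L - r. \<delta> (m + r) / (?P (L - (m + r)) * ?P m * ?P (m + r + r + s)))"
      by (rule sum.reindex_bij_witness[of _ "\<lambda>m. m + r" "\<lambda>n. n - r"]) (use r in auto)
    also have "\<dots> = (\<Sum>m\<le>L - r. \<delta> r / ?P (2 * r + s) *
                 (vander_weight p c (w * p ^ r) m / (?P (L - r - m) * ?P m * qpoch c p m)))"
      unfolding P d by (intro sum.cong refl) (simp add: add.commute)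
    also have "\<dots> = \<delta> r / ?P (2 * r + s) * (qpoch (w * p ^ r) p (L - r) / (?P (L - r) * qpoch c p (L - r)))"
      unfolding sum_distrib_left[symmetric] q_chu_vandermonde[OF p c] ..
    also have "\<dots> = \<delta> r * (qpoch w p L / qpoch w p r) / (?P (L - r) * ?P (L + r + s))"
    proof -
      have "?P (L + r + s) = ?P (2 * r + s) * qpoch c p (L - r)"
        using P[of "L - r"] r by simp
      moreover have "qpoch w p L / qpoch w p r = qpoch (w * p ^ r) p (L - r)"
        using qpoch_add[of w p r "L - r"] r by simp
      ultimately show ?thesis by simp
    qed
    finally show ?thesis .
  qed
  have "(\<Sum>n\<le>L. \<delta> n * \<beta> n / ?P (L - n))
     = (\<Sum>n\<le>L. \<Sum>r\<le>n. \<alpha> r * (\<delta> n / (?P (L - n) * ?P (n - r) * ?P (n + r + s))))"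
    using bp unfolding bailey_pair_def
    by (simp add: sum_distrib_left sum_divide_distrib) (intro sum.cong refl, simp add: mult_ac)
  also have "\<dots> = (\<Sum>r\<le>L. \<Sum>n\<in>{r..L}. \<alpha> r * (\<delta> n / (?P (L - n) * ?P (n - r) * ?P (n + r + s))))"
    (is "(\<Sum>n\<le>L. \<Sum>r\<le>n. ?f n r) = _")
  proof -
    have "(\<Sum>n\<le>L. \<Sum>r\<le>n. ?f n r) = (\<Sum>(n, r)\<in>(SIGMA n:{..L}. {..n}). ?f n r)"
      by (rule sum.Sigma) auto
    also have "\<dots> = (\<Sum>(r, n)\<in>(SIGMA r:{..L}. {r..L}). ?f n r)"
      by (rule sum.reindex_bij_witness[of _ "\<lambda>(r, n). (n, r)" "\<lambda>(n, r). (r, n)"]) auto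
    also have "\<dots> = (\<Sum>r\<le>L. \<Sum>n\<in>{r..L}. ?f n r)"
      by (rule sum.Sigma[symmetric]) auto
    finally show ?thesis .
  qed
  also have "\<dots> = (\<Sum>r\<le>L. \<alpha> r * (\<delta> r * (qpoch w p L / qpoch w p r) / (?P (L - r) * ?P (L + r + s))))"
  proof (intro sum.cong refl)
    fix r assume "r \<in> {..L}"
    then show "(\<Sum>n\<in>{r..L}. \<alpha> r * (\<delta> n / (?P (L - n) * ?P (n - r) * ?P (n + r + s))))
        = \<alpha> r * (\<delta> r * (qpoch w p L / qpoch w p r) / (?P (L - r) * ?P (L + r + s)))"
      by (subst sum_distrib_left[symmetric], subst inner) simp_all
  qed
  finally show "(\<Sum>n\<le>L. \<delta> n * \<beta> n / ?P (L - n)) / qpoch w p L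
     = (\<Sum>r\<le>L. \<delta> r / qpoch w p r * \<alpha> r / (?P (L - r) * ?P (L + r + s)))"
    by (simp add: sum_divide_distrib) (intro sum.cong refl, simp)
qed

section \<open>The finite Jacobi triple product\<close>

text \<open>The term \<open>(-1)^n x^(n(n+1)/2) y^(n(n-1)/2)\<close> of the theta series with \<open>p = x y\<close>. In this symmetric form the
  terms with negative index are obtained by exchanging \<open>x\<close> and \<open>y\<close>, so all exponents are natural
  numbers and neither \<open>x\<close> nor \<open>y\<close> has to be inverted.\<close>

definition theta_term :: "complex \<Rightarrow> complex \<Rightarrow> nat \<Rightarrow> complex" where
  "theta_term x y n = (-1) ^ n * x ^ triangle n * y ^ triangle (n - 1)"

lemma theta_term_0 [simp]: "theta_term x y 0 = 1"
  by (simp add: theta_term_def)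

lemma theta_term_Suc: "theta_term x y (Suc n) = - theta_term x y n * x * (x * y) ^ n"
  by (cases n) (simp_all add: theta_term_def power_add power_mult_distrib mult_ac)

definition theta_term_int :: "complex \<Rightarrow> complex \<Rightarrow> int \<Rightarrow> complex" where
  "theta_term_int x y r = (if r \<ge> 0 then theta_term x y (nat r) else theta_term y x (nat (- r)))"

lemma theta_term_int_uminus: "theta_term_int x y (- r) = theta_term_int y x r"
  by (auto simp: theta_term_int_def)

lemma theta_term_int_shift_down:
  assumes "- int n \<le> r"
  shows "theta_term_int x y (r - 1) * (x * y) ^ nat (int n + r) = - theta_term_int x y r * (y * (x * y) ^ n)"
proof (cases "r \<ge> 1")
  case True
  define k where "k = nat (r - 1)"
  have k: "r = int (Suc k)" using True by (simp add: k_def)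
  have "theta_term_int x y (r - 1) = theta_term x y k"
    using True by (simp add: theta_term_int_def k_def)
  moreover have "theta_term_int x y r = theta_term x y (Suc k)"
    unfolding k theta_term_int_def by (simp only: nat_int of_nat_0_le_iff if_True)
  moreover have "nat (int n + r) = n + Suc k"
    using k by simp
  ultimately show ?thesis
    by (simp add: theta_term_Suc power_add mult_ac)
next
  case False
  then obtain k where k: "r = - int k" by (metis int_cases2 int_one_le_iff_zero_less of_nat_0_less_iff neg_0_equal_iff_equal of_nat_0 not_gr_zero)
  with assms have "k \<le> n" by simp
  then have "int n + r = int (n - k)" "(x * y) ^ n = (x * y) ^ (n - k) * (x * y) ^ k"
    using k by (auto simp flip: power_add)
  moreover have "theta_term_int x y (r - 1) = theta_term y x (Suc k)"
    using k by (simp add: theta_term_int_def nat_add_distrib Suc_nat_eq_nat_zadd1)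
  moreover have "theta_term_int x y r = theta_term y x k"
    unfolding k theta_term_int_uminus by (simp add: theta_term_int_def)
  ultimately show ?thesis by (simp add: theta_term_Suc mult_ac)
qed

lemma theta_term_int_shift_up:
  assumes "r \<le> int n"
  shows "theta_term_int x y (r + 1) * (x * y) ^ nat (int n - r) = - theta_term_int x y r * (x * (x * y) ^ n)"
  using theta_term_int_shift_down[of n "- r" y x] theta_term_int_uminus[of y x "r + 1"] theta_term_int_uminus[of y x r] assms
  by (simp add: mult.commute)

text \<open>The value \<open>0\<close> at negative arguments is the natural convention \<open>1 / (p;p)_k = 0\<close> for \<open>k < 0\<close>: with it
  \<open>(1 - p^k) / (p;p)_k = 1 / (p;p)_(k-1)\<close> holds for all integers, and summation ranges can be
  shifted freely.\<close>

definition recip_qfact :: "complex \<Rightarrow> int \<Rightarrow> complex" where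
  "recip_qfact p k = (if k < 0 then 0 else 1 / qpoch p p (nat k))"

lemma recip_qfact_neg [simp]: "k < 0 \<Longrightarrow> recip_qfact p k = 0"
  by (simp add: recip_qfact_def)

lemma recip_qfact_of_nat [simp]: "recip_qfact p (int k) = 1 / qpoch p p k"
  by (simp add: recip_qfact_def)

lemma recip_qfact_step:
  assumes "norm p < 1"
  shows "(1 - p ^ nat k) * recip_qfact p k = recip_qfact p (k - 1)"
proof (cases "k > 0")
  case True
  then obtain m where m: "k = int (Suc m)" by (metis pos_int_cases gr0_implies_Suc)
  have "1 - p * p ^ m \<noteq> 0" by (rule one_minus_mult_power_nonzero[OF assms assms])
  moreover have "recip_qfact p (k - 1) = 1 / qpoch p p m" using m by (simp add: recip_qfact_def)
  moreover have "recip_qfact p k = 1 / qpoch p p (Suc m)" using m by (simp only: recip_qfact_of_nat)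
  moreover have "nat k = Suc m" using m by simp
  ultimately show ?thesis by (simp add: qpoch_Suc)
qed auto

lemma sum_int_shift: "(\<Sum>r\<in>{a..b::int}. f (r + c)) = (\<Sum>r\<in>{a + c..b + c}. f r)"
  by (rule sum.reindex_bij_witness[of _ "\<lambda>r. r - c" "\<lambda>r. r + c"]) auto

text \<open>The two sums are proved alternately: the even one for \<open>n\<close> gives the odd one for \<open>n\<close>, which gives
  the even one for \<open>n + 1\<close>. Each step is a Pascal recurrence. For the first, split
  \<open>1 - p^(2n+1) = (1 - p^(n+1+r)) + p^(n+1+r) (1 - p^(n-r))\<close> and shift \<open>r\<close> in the second part;
  by \<open>theta_term_int_shift_down\<close> the shift produces the constant factor \<open>- y p^n\<close>.\<close>

lemma finite_jacobi_triple_product: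
  assumes p: "norm p < 1" and xy: "p = x * y"
  shows "(\<Sum>r\<in>{-int n..int n}. theta_term_int x y r * recip_qfact p (int n - r) * recip_qfact p (int n + r))
           = qpoch x p n * qpoch y p n / qpoch p p (2 * n)" (is "?E n")
    and "(\<Sum>r\<in>{-int n - 1..int n}. theta_term_int x y r * recip_qfact p (int n - r) * recip_qfact p (int n + 1 + r))
           = qpoch x p n * qpoch y p (Suc n) / qpoch p p (Suc (2 * n))" (is "?O n")
proof -
  let ?t = "theta_term_int x y" and ?g = "recip_qfact p"
  note step = recip_qfact_step[OF p]
  have pnz: "1 - p ^ Suc k \<noteq> 0" for k
    using one_minus_mult_power_nonzero[OF p p, of k] by simp
  have lin: "Z + - a * b * Z = (1 - a * b) * Z" for a b Z :: complex
    by (simp add: algebra_simps)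
  have EO: "?O n" if "?E n" for n
  proof -
    let ?I = "{-int n - 1..int n}"
    have "(1 - p ^ (2 * n + 1)) * (\<Sum>r\<in>?I. ?t r * ?g (int n - r) * ?g (int n + 1 + r))
        = (\<Sum>r\<in>?I. ?t r * ?g (int n - r) * ?g (int n + r))
          + (\<Sum>r\<in>?I. ?t r * p ^ nat (int n + 1 + r) * ?g (int n - (r + 1)) * ?g (int n + (r + 1)))"
      unfolding sum_distrib_left sum.distrib[symmetric]
    proof (intro sum.cong refl)
      fix r assume r: "r \<in> ?I"
      have "2 * n + 1 = nat (int n + 1 + r) + nat (int n - r)" using r by auto
      then have "1 - p ^ (2 * n + 1) = (1 - p ^ nat (int n + 1 + r)) + p ^ nat (int n + 1 + r) * (1 - p ^ nat (int n - r))"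
        by (simp only: power_add) (simp add: algebra_simps)
      then have "(1 - p ^ (2 * n + 1)) * (?t r * ?g (int n - r) * ?g (int n + 1 + r))
         = ?t r * ?g (int n - r) * ((1 - p ^ nat (int n + 1 + r)) * ?g (int n + 1 + r))
          + ?t r * p ^ nat (int n + 1 + r) * ((1 - p ^ nat (int n - r)) * ?g (int n - r)) * ?g (int n + 1 + r)"
        by (simp only:) (simp add: algebra_simps)
      then show "(1 - p ^ (2 * n + 1)) * (?t r * ?g (int n - r) * ?g (int n + 1 + r))
         = ?t r * ?g (int n - r) * ?g (int n + r)
          + ?t r * p ^ nat (int n + 1 + r) * ?g (int n - (r + 1)) * ?g (int n + (r + 1))"
        using step[of "int n + 1 + r"] step[of "int n - r"] by (simp add: add_ac diff_diff_eq)
    qed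
    \<comment> \<open>The summand at \<open>r = - n - 1\<close>, and after the shift the one at \<open>r = n + 1\<close>, vanish by the convention for \<open>?g\<close>.\<close>
    also have "(\<Sum>r\<in>?I. ?t r * ?g (int n - r) * ?g (int n + r))
        = (\<Sum>r\<in>{-int n..int n}. ?t r * ?g (int n - r) * ?g (int n + r))"
      by (rule sum.mono_neutral_right) auto
    also have "(\<Sum>r\<in>?I. ?t r * p ^ nat (int n + 1 + r) * ?g (int n - (r + 1)) * ?g (int n + (r + 1)))
        = (\<Sum>r\<in>{-int n..int n + 1}. ?t (r - 1) * p ^ nat (int n + r) * ?g (int n - r) * ?g (int n + r))"
      using sum_int_shift[of "\<lambda>r. ?t (r - 1) * p ^ nat (int n + r) * ?g (int n - r) * ?g (int n + r)" 1 "-int n - 1" "int n"]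
      by (simp add: add_ac)
    also have "\<dots> = (\<Sum>r\<in>{-int n..int n}. ?t (r - 1) * p ^ nat (int n + r) * ?g (int n - r) * ?g (int n + r))"
      by (rule sum.mono_neutral_right) auto
    also have "\<dots> = (\<Sum>r\<in>{-int n..int n}. (- y * p ^ n) * (?t r * ?g (int n - r) * ?g (int n + r)))"
      by (intro sum.cong refl) (use theta_term_int_shift_down[of n _ x y] in \<open>simp add: xy mult_ac\<close>)
    also have "(\<Sum>r\<in>{-int n..int n}. ?t r * ?g (int n - r) * ?g (int n + r)) + \<dots>
        = (1 - y * p ^ n) * (qpoch x p n * qpoch y p n / qpoch p p (2 * n))"
      unfolding sum_distrib_left[symmetric] that by (rule lin)
    also have "\<dots> = (1 - p ^ (2 * n + 1)) * (qpoch x p n * qpoch y p (Suc n) / qpoch p p (Suc (2 * n)))"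
      using pnz[of "2 * n"] by (simp add: qpoch_Suc)
    finally show ?thesis
      using pnz[of "2 * n"] by (subst (asm) mult_left_cancel) simp_all
  qed
  have OE: "?E (Suc n)" if "?O n" for n
  proof -
    let ?I = "{-int (Suc n)..int (Suc n)}"
    have "(1 - p ^ (2 * n + 2)) * (\<Sum>r\<in>?I. ?t r * ?g (int (Suc n) - r) * ?g (int (Suc n) + r))
        = (\<Sum>r\<in>?I. ?t r * ?g (int n - r) * ?g (int n + 1 + r))
          + (\<Sum>r\<in>?I. ?t r * p ^ nat (int n + 1 - r) * ?g (int n - (r + - 1)) * ?g (int n + 1 + (r + - 1)))"
      unfolding sum_distrib_left sum.distrib[symmetric]
    proof (intro sum.cong refl)
      fix r assume r: "r \<in> ?I"
      have "2 * n + 2 = nat (int n + 1 - r) + nat (int n + 1 + r)" using r by auto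
      then have "1 - p ^ (2 * n + 2) = (1 - p ^ nat (int n + 1 - r)) + p ^ nat (int n + 1 - r) * (1 - p ^ nat (int n + 1 + r))"
        by (simp only: power_add) (simp add: algebra_simps)
      then have "(1 - p ^ (2 * n + 2)) * (?t r * ?g (int n + 1 - r) * ?g (int n + 1 + r))
         = ?t r * ((1 - p ^ nat (int n + 1 - r)) * ?g (int n + 1 - r)) * ?g (int n + 1 + r)
          + ?t r * p ^ nat (int n + 1 - r) * ?g (int n + 1 - r) * ((1 - p ^ nat (int n + 1 + r)) * ?g (int n + 1 + r))"
        by (simp only:) (simp add: algebra_simps)
      then show "(1 - p ^ (2 * n + 2)) * (?t r * ?g (int (Suc n) - r) * ?g (int (Suc n) + r))
         = ?t r * ?g (int n - r) * ?g (int n + 1 + r)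
          + ?t r * p ^ nat (int n + 1 - r) * ?g (int n - (r + - 1)) * ?g (int n + 1 + (r + - 1))"
        using step[of "int n + 1 + r"] step[of "int n + 1 - r"] by (simp add: add_ac diff_diff_eq diff_diff_eq2)
    qed
    also have "(\<Sum>r\<in>?I. ?t r * ?g (int n - r) * ?g (int n + 1 + r))
        = (\<Sum>r\<in>{-int n - 1..int n}. ?t r * ?g (int n - r) * ?g (int n + 1 + r))"
      by (rule sum.mono_neutral_right) auto
    also have "(\<Sum>r\<in>?I. ?t r * p ^ nat (int n + 1 - r) * ?g (int n - (r + - 1)) * ?g (int n + 1 + (r + - 1)))
        = (\<Sum>r\<in>{- 2 - int n..int n}. ?t (r + 1) * p ^ nat (int n - r) * ?g (int n - r) * ?g (int n + 1 + r))"
      using sum_int_shift[of "\<lambda>r. ?t (r + 1) * p ^ nat (int n - r) * ?g (int n - r) * ?g (int n + 1 + r)" "- 1" "-int (Suc n)" "int (Suc n)"]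
      by (simp add: algebra_simps)
    also have "\<dots> = (\<Sum>r\<in>{-int n - 1..int n}. ?t (r + 1) * p ^ nat (int n - r) * ?g (int n - r) * ?g (int n + 1 + r))"
      by (rule sum.mono_neutral_right) auto
    also have "\<dots> = (\<Sum>r\<in>{-int n - 1..int n}. (- x * p ^ n) * (?t r * ?g (int n - r) * ?g (int n + 1 + r)))"
      by (intro sum.cong refl) (use theta_term_int_shift_up[of _ n x y] in \<open>simp add: xy mult_ac\<close>)
    also have "(\<Sum>r\<in>{-int n - 1..int n}. ?t r * ?g (int n - r) * ?g (int n + 1 + r)) + \<dots>
        = (1 - x * p ^ n) * (qpoch x p n * qpoch y p (Suc n) / qpoch p p (Suc (2 * n)))"
      unfolding sum_distrib_left[symmetric] that by (rule lin)
    also have "\<dots> = (1 - p ^ (2 * n + 2)) * (qpoch x p (Suc n) * qpoch y p (Suc n) / qpoch p p (2 * Suc n))"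
      using pnz[of "Suc (2 * n)"] by (simp add: qpoch_Suc)
    finally show ?thesis
      using pnz[of "Suc (2 * n)"] by (subst (asm) mult_left_cancel) simp_all
  qed
  show E: "?E n"
  proof (induction n)
    case 0
    have "recip_qfact p 0 = 1" using recip_qfact_of_nat[of p 0] by simp
    then show ?case by (simp add: theta_term_int_def)
  next
    case (Suc n)
    then show ?case by (intro OE EO)
  qed
  then show "?O n" by (rule EO)
qed

text \<open>The bilateral theta series folded to one side: the indices \<open>r\<close> and \<open>- r - s\<close>, for which the
  denominators \<open>(p;p)_(n-r) (p;p)_(n+r+s)\<close> agree, are taken together. Only for \<open>r = s = 0\<close> do the two coincide.\<close>

definition theta_pair :: "complex \<Rightarrow> complex \<Rightarrow> nat \<Rightarrow> nat \<Rightarrow> complex" where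
  "theta_pair x y s r =
     (if s = 0 \<and> r = 0 then 1 else theta_term x y r + theta_term y x (r + s))"

lemma sum_int_fold:
  "(\<Sum>r\<in>{- int n - int s..int n}. f r)
     = (\<Sum>r\<le>n. if s = 0 \<and> r = 0 then f 0 else f (int r) + f (- int r - int s))"
  if "s \<le> 1" for f :: "int \<Rightarrow> complex"
proof (induction n)
  case 0
  have "s = 0 \<or> s = 1" using that by auto
  moreover have "{- 1..0::int} = {-1, 0}" by auto
  ultimately show ?case by auto
next
  case (Suc n)
  have "{- int (Suc n) - int s..int (Suc n)}
      = insert (int (Suc n)) (insert (- int (Suc n) - int s) {- int n - int s..int n})"
    by auto
  then show ?case using Suc by simp
qed

text \<open>The finite Jacobi triple product, with the bilateral sum folded. It is the source of the Bailey
  pair that starts the chain and, in the limit, of the product evaluation that ends it.\<close>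

lemma theta_bailey_pair:
  assumes p: "norm p < 1" and xy: "p = x * y" and s: "s \<le> 1"
  shows "bailey_pair p s (theta_pair x y s)
           (\<lambda>n. qpoch x p n * qpoch y p (n + s) / qpoch p p (2 * n + s))"
  unfolding bailey_pair_def
proof
  fix n
  let ?F = "\<lambda>r. theta_term_int x y r * recip_qfact p (int n - r) * recip_qfact p (int n + int s + r)"
  have "s = 0 \<or> s = 1" using s by auto
  then have "qpoch x p n * qpoch y p (n + s) / qpoch p p (2 * n + s) = (\<Sum>r\<in>{- int n - int s..int n}. ?F r)"
    using finite_jacobi_triple_product[OF p xy, of n] by auto
  also have "\<dots> = (\<Sum>r\<le>n. theta_pair x y s r / (qpoch p p (n - r) * qpoch p p (n + r + s)))"
    unfolding sum_int_fold[OF s]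
  proof (intro sum.cong refl)
    fix r assume r: "r \<in> {..n}"
    have e: "int n - int r = int (n - r)" "int n + int s + int r = int (n + r + s)"
      "int n - (- int r - int s) = int (n + r + s)" "int n + int s + (- int r - int s) = int (n - r)"
      using r by auto
    have "theta_term_int x y (- int r - int s) = theta_term y x (r + s)"
    proof -
      have "- int r - int s = - int (r + s)" by simp
      then show ?thesis
        by (simp only: theta_term_int_uminus) (simp add: theta_term_int_def flip: of_nat_add)
    qed
    then have b: "?F (- int r - int s) = theta_term y x (r + s) / (qpoch p p (n - r) * qpoch p p (n + r + s))"
      by (simp only: e recip_qfact_of_nat) simp
    have "theta_term_int x y (int r) = theta_term x y r"
      by (simp add: theta_term_int_def)
    then have a: "?F (int r) = theta_term x y r / (qpoch p p (n - r) * qpoch p p (n + r + s))"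
      by (simp only: e recip_qfact_of_nat) simp
    show "(if s = 0 \<and> r = 0 then ?F 0 else ?F (int r) + ?F (- int r - int s))
        = theta_pair x y s r / (qpoch p p (n - r) * qpoch p p (n + r + s))"
    proof (cases "s = 0 \<and> r = 0")
      case True
      then show ?thesis using a by (simp add: theta_pair_def)
    next
      case False
      then show ?thesis unfolding a b by (auto simp: theta_pair_def add_divide_distrib)
    qed
  qed
  finally show "qpoch x p n * qpoch y p (n + s) / qpoch p p (2 * n + s) = \<dots>" .
qed

section \<open>Infinite products and limits of Bailey pairs\<close>

lemma qpoch_convergent_prod:
  fixes a p :: complex
  assumes "norm p < 1"
  shows "convergent_prod (\<lambda>k. 1 - a * p ^ k)"
proof (intro abs_convergent_prod_imp_convergent_prod summable_imp_abs_convergent_prod)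
  have "summable (\<lambda>k. norm a * norm p ^ k)"
    using assms by (intro summable_mult summable_geometric) auto
  then show "summable (\<lambda>k. norm (1 - a * p ^ k - 1))"
    by (simp add: norm_mult norm_power)
qed

lemma qpoch_LIMSEQ:
  assumes "norm p < 1"
  shows "(\<lambda>n. qpoch a p n) \<longlonglongrightarrow> qpoch_inf a p"
proof -
  have "(\<lambda>n. qpoch a p (Suc n)) \<longlonglongrightarrow> qpoch_inf a p"
    using convergent_prod_LIMSEQ[OF qpoch_convergent_prod[OF assms, of a]]
    by (simp add: qpoch_def qpoch_inf_def lessThan_Suc_atMost)
  then show ?thesis by (rule LIMSEQ_imp_Suc)
qed

lemma qpoch_inf_nonzero: "norm p < 1 \<Longrightarrow> norm a < 1 \<Longrightarrow> qpoch_inf a p \<noteq> 0"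
  unfolding qpoch_inf_def
  by (intro prodinf_nonzero qpoch_convergent_prod one_minus_mult_power_nonzero)

lemma qpoch_bounded:
  assumes "norm p < 1"
  obtains B where "\<And>n. norm (qpoch a p n) \<le> B"
  using convergent_imp_Bseq[OF convergentI[OF qpoch_LIMSEQ[OF assms, of a]]]
  unfolding Bseq_def by auto

lemma inverse_qpoch_bounded:
  assumes "norm p < 1" "norm a < 1"
  obtains B where "B > 0" "\<And>n. norm (inverse (qpoch a p n)) \<le> B"
  using convergent_imp_Bseq[OF convergentI[OF tendsto_inverse[OF qpoch_LIMSEQ[OF assms(1), of a] qpoch_inf_nonzero[OF assms]]]]
  unfolding Bseq_def by auto

lemma qpoch_inf_shift:
  assumes "norm p < 1"
  shows "qpoch_inf a p = (1 - a) * qpoch_inf (a * p) p"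
proof (rule LIMSEQ_unique)
  show "(\<lambda>n. qpoch a p (Suc n)) \<longlonglongrightarrow> qpoch_inf a p"
    by (rule LIMSEQ_Suc[OF qpoch_LIMSEQ[OF assms]])
  show "(\<lambda>n. qpoch a p (Suc n)) \<longlonglongrightarrow> (1 - a) * qpoch_inf (a * p) p"
    unfolding qpoch_Suc_left by (intro tendsto_intros qpoch_LIMSEQ assms)
qed

lemma qpoch_inf_bisect:
  assumes "norm p < 1"
  shows "qpoch_inf a p = qpoch_inf a (p\<^sup>2) * qpoch_inf (a * p) (p\<^sup>2)"
proof (rule LIMSEQ_unique)
  have p2: "norm (p\<^sup>2) < 1" by (rule norm_power_less_one[OF assms pos2])
  have "qpoch a p (2 * n) = qpoch a (p\<^sup>2) n * qpoch (a * p) (p\<^sup>2) n" for n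
    by (induction n) (simp_all add: qpoch_Suc mult_ac flip: power_mult)
  moreover have "(\<lambda>n. qpoch a p (2 * n)) \<longlonglongrightarrow> qpoch_inf a p"
    by (rule filterlim_compose[OF qpoch_LIMSEQ[OF assms]], rule filterlim_subseq) (auto simp: strict_mono_def)
  ultimately show "(\<lambda>n. qpoch a (p\<^sup>2) n * qpoch (a * p) (p\<^sup>2) n) \<longlonglongrightarrow> qpoch_inf a p"
    by simp
  show "(\<lambda>n. qpoch a (p\<^sup>2) n * qpoch (a * p) (p\<^sup>2) n) \<longlonglongrightarrow> qpoch_inf a (p\<^sup>2) * qpoch_inf (a * p) (p\<^sup>2)"
    by (intro tendsto_intros qpoch_LIMSEQ p2)
qed

lemma qpoch_inf_mult_uminus:
  assumes "norm p < 1"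
  shows "qpoch_inf a p * qpoch_inf (- a) p = qpoch_inf (a\<^sup>2) (p\<^sup>2)"
proof (rule LIMSEQ_unique)
  have p2: "norm (p\<^sup>2) < 1" by (rule norm_power_less_one[OF assms pos2])
  have "qpoch a p n * qpoch (- a) p n = qpoch (a\<^sup>2) (p\<^sup>2) n" for n
    by (induction n) (simp_all add: qpoch_Suc power2_eq_square power_mult_distrib algebra_simps)
  moreover have "(\<lambda>n. qpoch a p n * qpoch (- a) p n) \<longlonglongrightarrow> qpoch_inf a p * qpoch_inf (- a) p"
    by (intro tendsto_intros qpoch_LIMSEQ assms)
  ultimately show "(\<lambda>n. qpoch (a\<^sup>2) (p\<^sup>2) n) \<longlonglongrightarrow> qpoch_inf a p * qpoch_inf (- a) p"
    by simp
  show "(\<lambda>n. qpoch (a\<^sup>2) (p\<^sup>2) n) \<longlonglongrightarrow> qpoch_inf (a\<^sup>2) (p\<^sup>2)"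
    by (rule qpoch_LIMSEQ[OF p2])
qed

text \<open>Tannery's theorem for sums whose length grows with the index, as they come out of Bailey's lemma.\<close>

lemma tannery_atMost:
  fixes a :: "nat \<Rightarrow> nat \<Rightarrow> complex"
  assumes limit: "\<And>k. (\<lambda>n. a k n) \<longlonglongrightarrow> b k"
    and bound: "\<And>k n. k \<le> n \<Longrightarrow> norm (a k n) \<le> M k"
    and M: "summable M"
  shows "(\<lambda>n. \<Sum>k\<le>n. a k n) \<longlonglongrightarrow> suminf b"
proof -
  let ?a = "\<lambda>k n. if k \<le> n then a k n else 0"
  have "?a k \<longlonglongrightarrow> b k" for k
    by (rule Lim_transform_eventually[OF limit]) (use eventually_ge_at_top[of k] in eventually_elim, auto)
  moreover have "norm (?a k n) \<le> M k" for k n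
    using bound[of k n] order_trans[OF norm_ge_zero bound[of k k]] by auto
  ultimately have "(\<lambda>n. suminf (\<lambda>k. ?a k n)) \<longlonglongrightarrow> suminf b"
    using tannerys_theorem[of ?a b sequentially M, OF _ always_eventually M] by auto
  moreover have "suminf (\<lambda>k. ?a k n) = (\<Sum>k\<le>n. a k n)" for n
    by (subst suminf_finite[of "{..n}"]) auto
  ultimately show ?thesis by simp
qed

lemma qpoch_LIMSEQ_minus:
  "norm p < 1 \<Longrightarrow> (\<lambda>n. qpoch a p (n - k)) \<longlonglongrightarrow> qpoch_inf a p"
  by (rule filterlim_compose[OF qpoch_LIMSEQ filterlim_minus_const_nat_at_top])

lemma qpoch_LIMSEQ_plus:
  "norm p < 1 \<Longrightarrow> (\<lambda>n. qpoch a p (n + k)) \<longlonglongrightarrow> qpoch_inf a p"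
  by (rule LIMSEQ_ignore_initial_segment[OF qpoch_LIMSEQ])

lemma qpoch_convolution_LIMSEQ:
  assumes p: "norm p < 1" and b: "summable (\<lambda>n. norm (b n))"
  shows "(\<lambda>L. \<Sum>n\<le>L. b n / qpoch p p (L - n)) \<longlonglongrightarrow> suminf b / qpoch_inf p p"
proof -
  obtain B where B: "B > 0" "\<And>n. norm (inverse (qpoch p p n)) \<le> B"
    using inverse_qpoch_bounded[OF p p] by blast
  have "(\<lambda>L. \<Sum>n\<le>L. b n / qpoch p p (L - n)) \<longlonglongrightarrow> (\<Sum>n. b n / qpoch_inf p p)"
  proof (rule tannery_atMost[where M = "\<lambda>n. norm (b n) * B"])
    show "(\<lambda>L. b n / qpoch p p (L - n)) \<longlonglongrightarrow> b n / qpoch_inf p p" for n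
      by (intro tendsto_intros qpoch_LIMSEQ_minus p qpoch_inf_nonzero)
    show "norm (b n / qpoch p p (L - n)) \<le> norm (b n) * B" for n L
      unfolding divide_inverse norm_mult by (intro mult_left_mono B) auto
  qed (intro summable_mult2 b)
  also have "(\<Sum>n. b n / qpoch_inf p p) = suminf b / qpoch_inf p p"
    by (intro suminf_divide summable_norm_cancel[OF b])
  finally show ?thesis .
qed

lemma bailey_pair_LIMSEQ:
  assumes p: "norm p < 1" and bp: "bailey_pair p s \<alpha> \<beta>" and \<alpha>: "summable (\<lambda>r. norm (\<alpha> r))"
  shows "\<beta> \<longlonglongrightarrow> suminf \<alpha> / (qpoch_inf p p)\<^sup>2"
proof -
  obtain B where B: "B > 0" "\<And>n. norm (inverse (qpoch p p n)) \<le> B"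
    using inverse_qpoch_bounded[OF p p] by blast
  have "(\<lambda>n. \<Sum>r\<le>n. \<alpha> r / (qpoch p p (n - r) * qpoch p p (n + r + s))) \<longlonglongrightarrow> (\<Sum>r. \<alpha> r / (qpoch_inf p p)\<^sup>2)"
  proof (rule tannery_atMost[where M = "\<lambda>r. norm (\<alpha> r) * (B * B)"])
    show "(\<lambda>n. \<alpha> r / (qpoch p p (n - r) * qpoch p p (n + r + s))) \<longlonglongrightarrow> \<alpha> r / (qpoch_inf p p)\<^sup>2" for r
      unfolding power2_eq_square add.assoc
      by (intro tendsto_intros qpoch_LIMSEQ_minus qpoch_LIMSEQ_plus p) (simp add: qpoch_inf_nonzero p)
    show "norm (\<alpha> r / (qpoch p p (n - r) * qpoch p p (n + r + s))) \<le> norm (\<alpha> r) * (B * B)" for r n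
      unfolding divide_inverse norm_mult inverse_mult_distrib
      by (intro mult_left_mono mult_mono B) (use B in auto)
  qed (intro summable_mult2 \<alpha>)
  also have "(\<Sum>r. \<alpha> r / (qpoch_inf p p)\<^sup>2) = suminf \<alpha> / (qpoch_inf p p)\<^sup>2"
    by (intro suminf_divide summable_norm_cancel[OF \<alpha>])
  also have "(\<lambda>n. \<Sum>r\<le>n. \<alpha> r / (qpoch p p (n - r) * qpoch p p (n + r + s))) = \<beta>"
    using bp by (simp add: bailey_pair_def fun_eq_iff)
  finally show ?thesis .
qed

lemma triangle_ge: "n \<le> triangle n"
  by (induction n) auto

lemma norm_theta_term_le:
  assumes "norm (x * y) < 1" "norm x \<le> 1"
  shows "norm (theta_term x y n) \<le> norm (x * y) ^ (n - 1)"
proof -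
  have "norm (theta_term x y n) = norm x ^ (triangle n - triangle (n - 1)) * norm (x * y) ^ triangle (n - 1)"
    by (cases n) (simp_all add: theta_term_def norm_mult norm_power power_add power_mult_distrib)
  also have "\<dots> \<le> 1 * norm (x * y) ^ (n - 1)"
    using assms by (intro mult_mono power_le_one power_decreasing triangle_ge) auto
  finally show ?thesis by simp
qed

lemma summable_theta_pair:
  assumes "norm (x * y) < 1" "norm x \<le> 1" "norm y \<le> 1"
  shows "summable (\<lambda>r. norm (theta_pair x y s r))"
proof (rule summable_comparison_test)
  let ?m = "norm (x * y)"
  have "norm (theta_pair x y s r) \<le> 2 * ?m ^ (r - 1)" for r
  proof (cases "s = 0 \<and> r = 0")
    case False
    have "norm (theta_term x y r) \<le> ?m ^ (r - 1)"
      by (rule norm_theta_term_le[OF assms(1,2)])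
    moreover have "norm (theta_term y x (r + s)) \<le> ?m ^ (r + s - 1)"
      using norm_theta_term_le[of y x "r + s"] assms by (simp add: mult.commute)
    moreover have "?m ^ (r + s - 1) \<le> ?m ^ (r - 1)"
      using assms by (intro power_decreasing) auto
    ultimately show ?thesis
      using False norm_triangle_ineq[of "theta_term x y r" "theta_term y x (r + s)"]
      by (auto simp: theta_pair_def)
  qed (simp add: theta_pair_def)
  then show "\<exists>N. \<forall>r\<ge>N. norm (norm (theta_pair x y s r)) \<le> 2 * ?m ^ (r - 1)"
    by simp
  have "summable (\<lambda>r. ?m ^ (Suc r - 1))"
    using assms(1) by (simp add: summable_geometric)
  then show "summable (\<lambda>r. 2 * ?m ^ (r - 1))"
    by (intro summable_mult) (subst (asm) summable_Suc_iff)
qed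

text \<open>The two limits of the \<open>\<beta>\<close>-side of the theta Bailey pair, one from its product form and one from
  its series form, must agree. For \<open>s = 0\<close> and \<open>s = 1\<close> the series are two foldings of the same
  bilateral series.\<close>

theorem jacobi_triple_product:
  assumes p: "norm p < 1" and xy: "p = x * y" "norm x \<le> 1" "norm y \<le> 1" and s: "s \<le> 1"
  shows "suminf (theta_pair x y s) = qpoch_inf x p * qpoch_inf y p * qpoch_inf p p"
proof -
  let ?\<beta> = "\<lambda>n. qpoch x p n * qpoch y p (n + s) / qpoch p p (2 * n + s)"
  have nz: "qpoch_inf p p \<noteq> 0" by (rule qpoch_inf_nonzero[OF p p])
  have "(\<lambda>n. qpoch p p (2 * n + s)) \<longlonglongrightarrow> qpoch_inf p p"
    by (rule filterlim_compose[OF qpoch_LIMSEQ[OF p]], rule filterlim_subseq) (auto simp: strict_mono_def)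
  then have "?\<beta> \<longlonglongrightarrow> qpoch_inf x p * qpoch_inf y p / qpoch_inf p p"
    by (intro tendsto_intros qpoch_LIMSEQ qpoch_LIMSEQ_plus p nz)
  moreover have "?\<beta> \<longlonglongrightarrow> suminf (theta_pair x y s) / (qpoch_inf p p)\<^sup>2"
    using p xy by (intro bailey_pair_LIMSEQ[OF p theta_bailey_pair[OF p xy(1) s]] summable_theta_pair) auto
  ultimately have "qpoch_inf x p * qpoch_inf y p / qpoch_inf p p = suminf (theta_pair x y s) / (qpoch_inf p p)\<^sup>2"
    by (rule LIMSEQ_unique)
  then show ?thesis using nz by (simp add: field_simps power2_eq_square)
qed

text \<open>Two Bailey steps and a limit. The theta pair with \<open>x = 1\<close> has \<open>\<beta>_n = 0\<close> for \<open>n > 0\<close>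
  because \<open>(1;p)_n = 0\<close>. The first step, with \<open>w = 0\<close>, gives \<open>\<beta>_n = 1 / (p;p)_n\<close>; the second keeps
  \<open>w\<close> free. For \<open>w = - q\<close>, \<open>- q\<^sup>3\<close> and \<open>p = q\<^sup>2\<close> the right-hand series becomes a theta series.\<close>

theorem bailey_slater_sum:
  assumes p: "norm p < 1" and w: "norm w < 1" and s: "s \<le> 1"
  defines "\<delta> \<equiv> vander_weight p (p ^ Suc s)"
  assumes \<alpha>: "summable (\<lambda>r. norm (\<delta> w r / qpoch w p r * (\<delta> 0 r * theta_pair 1 p s r)))"
    and \<beta>: "summable (\<lambda>n. norm (\<delta> w n / qpoch p p n))"
  shows "(\<Sum>n. \<delta> w n / qpoch p p n)
           = qpoch_inf w p / qpoch_inf p p * (\<Sum>r. \<delta> w r / qpoch w p r * (\<delta> 0 r * theta_pair 1 p s r))"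
proof -
  note nz = qpoch_nonzero[OF p p]
  have "qpoch 1 p n * qpoch p p (n + s) / qpoch p p (2 * n + s) = (if n = 0 then 1 else 0)" for n
    using nz by (cases n) (simp_all add: qpoch_Suc_left)
  then have "bailey_pair p s (theta_pair 1 p s) (\<lambda>n. if n = 0 then 1 else 0)"
    using theta_bailey_pair[of p 1 p s] p s by simp
  from bailey_lemma[OF p _ this, of 0]
  have "bailey_pair p s (\<lambda>r. \<delta> 0 r / qpoch 0 p r * theta_pair 1 p s r)
          (\<lambda>L. (\<Sum>n\<le>L. \<delta> 0 n * (if n = 0 then 1 else 0) / qpoch p p (L - n)) / qpoch 0 p L)"
    by (simp add: \<delta>_def)
  moreover have "qpoch 0 p n = 1" for n by (simp add: qpoch_def)
  moreover have "(\<Sum>n\<le>L. \<delta> 0 n * (if n = 0 then 1 else 0) / qpoch p p (L - n)) = 1 / qpoch p p L" for L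
    by (subst sum.mono_neutral_right[of _ "{0}"]) (auto simp: \<delta>_def)
  ultimately have "bailey_pair p s (\<lambda>r. \<delta> 0 r * theta_pair 1 p s r) (\<lambda>L. 1 / qpoch p p L)"
    by simp
  from bailey_pair_LIMSEQ[OF p bailey_lemma[OF p w this]] \<alpha>
  have "(\<lambda>L. (\<Sum>n\<le>L. \<delta> w n / qpoch p p n / qpoch p p (L - n)) / qpoch w p L)
      \<longlonglongrightarrow> (\<Sum>r. \<delta> w r / qpoch w p r * (\<delta> 0 r * theta_pair 1 p s r)) / (qpoch_inf p p)\<^sup>2"
    by (simp add: \<delta>_def)
  moreover have "(\<lambda>L. (\<Sum>n\<le>L. \<delta> w n / qpoch p p n / qpoch p p (L - n)) / qpoch w p L)
      \<longlonglongrightarrow> (\<Sum>n. \<delta> w n / qpoch p p n) / qpoch_inf p p / qpoch_inf w p"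
    by (intro tendsto_divide qpoch_convolution_LIMSEQ qpoch_LIMSEQ qpoch_inf_nonzero p w \<beta>)
  ultimately have "(\<Sum>n. \<delta> w n / qpoch p p n) / qpoch_inf p p / qpoch_inf w p
      = (\<Sum>r. \<delta> w r / qpoch w p r * (\<delta> 0 r * theta_pair 1 p s r)) / (qpoch_inf p p)\<^sup>2"
    by (rule LIMSEQ_unique[rotated])
  then show ?thesis
    using qpoch_inf_nonzero[OF p p] qpoch_inf_nonzero[OF p w]
    by (simp add: field_simps power2_eq_square)
qed

section \<open>Reduction of the double sums to single sums\<close>

text \<open>The \<open>q\<close>-binomial theorem as a uniqueness statement: the functional equation is that of
  \<open>(-x q;q\<^sup>2)_\<infinity> / (x;q\<^sup>2)_\<infinity>\<close>, and it determines the coefficients recursively.\<close>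

lemma fps_q_binomial_nth:
  fixes C :: "complex fps"
  assumes q: "norm q < 1"
    and eq: "(1 - fps_X) * C = (1 + fps_const q * fps_X) * (C oo (fps_const (q\<^sup>2) * fps_X))"
    and C0: "fps_nth C 0 = 1"
  shows "fps_nth C n = qpoch (- q) (q\<^sup>2) n / qpoch (q\<^sup>2) (q\<^sup>2) n"
proof (induction n)
  case (Suc n)
  have "fps_nth C (Suc n) - fps_nth C n = (q\<^sup>2) ^ Suc n * fps_nth C (Suc n) + q * ((q\<^sup>2) ^ n * fps_nth C n)"
    using arg_cong[OF eq, of "\<lambda>F. fps_nth F (Suc n)"]
    by (simp add: distrib_right left_diff_distrib mult.assoc del: power_Suc)
  then have "(1 - q\<^sup>2 * (q\<^sup>2) ^ n) * fps_nth C (Suc n) = (1 + q * (q\<^sup>2) ^ n) * fps_nth C n"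
    by (simp add: algebra_simps)
  moreover have q2: "norm (q\<^sup>2) < 1"
    by (rule norm_power_less_one[OF q pos2])
  have "1 - q\<^sup>2 * (q\<^sup>2) ^ n \<noteq> 0" by (rule one_minus_mult_power_nonzero[OF q2 q2])
  ultimately have "fps_nth C (Suc n) = fps_nth C n * (1 + q * (q\<^sup>2) ^ n) / (1 - q\<^sup>2 * (q\<^sup>2) ^ n)"
    by (simp add: field_simps)
  then show ?case by (simp add: Suc qpoch_Suc)
qed (simp add: C0)

text \<open>\<open>A\<close> and \<open>B\<close> are the expansions of \<open>(-x;q)_\<infinity>\<close> and \<open>1 / (x\<^sup>2;q\<^sup>4)_\<infinity>\<close>. Replacing \<open>x\<close> by \<open>q\<^sup>2 x\<close> divides
  \<open>A\<close> by \<open>(1 + x) (1 + q x)\<close> and multiplies \<open>B\<close> by \<open>(1 - x) (1 + x)\<close>; in the product the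
  factor \<open>1 + x\<close> cancels.\<close>

lemma antidiagonal_sum:
  assumes q: "norm q < 1"
  shows "(\<Sum>(i, j) \<in> {(i, j). i + 2 * j = N}. q ^ triangle (i - 1) / (qpoch q q i * qpoch (q ^ 4) (q ^ 4) j))
          = qpoch (- q) (q\<^sup>2) N / qpoch (q\<^sup>2) (q\<^sup>2) N"
proof -
  have q4: "norm (q ^ 4) < 1" by (intro norm_power_less_one q) simp
  define A where "A = Abs_fps (\<lambda>i. q ^ triangle (i - 1) / qpoch q q i)"
  define B where "B = Abs_fps (\<lambda>n. if even n then 1 / qpoch (q ^ 4) (q ^ 4) (n div 2) else 0)"
  let ?S = "\<lambda>F c. F oo (fps_const c * fps_X)"
  have A_step: "A = (1 + fps_X) * ?S A q"
  proof (rule fps_ext)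
    fix n show "fps_nth A n = fps_nth ((1 + fps_X) * ?S A q) n"
    proof (cases n)
      case (Suc k)
      have "1 - q * q ^ k \<noteq> 0" by (rule one_minus_mult_power_nonzero[OF q q])
      then have "fps_nth A (Suc k) * (1 - q * q ^ k) = q ^ k * fps_nth A k"
        by (cases k) (simp_all add: A_def qpoch_Suc power_add mult_ac)
      then show ?thesis by (simp add: Suc distrib_right) (simp add: algebra_simps)
    qed simp
  qed
  have "?S (?S A q) q = ?S A (q\<^sup>2)"
    by (simp add: fps_eq_iff power_mult_distrib power2_eq_square)
  moreover have "?S A q = (1 + fps_const q * fps_X) * ?S (?S A q) q"
    by (subst A_step) (simp add: fps_compose_mult_distrib fps_compose_add_distrib)
  ultimately have A2: "A = (1 + fps_X) * ((1 + fps_const q * fps_X) * ?S A (q\<^sup>2))"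
    using A_step by simp
  have B2: "?S B (q\<^sup>2) = (1 - fps_X) * ((1 + fps_X) * B)"
  proof (rule fps_ext)
    have *: "(1 - fps_X) * ((1 + fps_X) * B) = B - fps_X * (fps_X * B)" by (simp add: algebra_simps)
    fix n show "fps_nth (?S B (q\<^sup>2)) n = fps_nth ((1 - fps_X) * ((1 + fps_X) * B)) n"
    proof (cases "even n \<and> n > 0")
      case True
      define k where "k = n div 2 - 1"
      have k: "n = Suc (Suc (2 * k))"
        using True by (auto simp: k_def elim!: evenE)
      have nz: "1 - q ^ 4 * (q ^ 4) ^ k \<noteq> 0" by (rule one_minus_mult_power_nonzero[OF q4 q4])
      have "(q\<^sup>2) ^ n = q ^ (2 * n)"
        by (simp only: power_mult)
      also have "2 * n = 4 + 4 * k"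
        by (simp add: k)
      also have "q ^ (4 + 4 * k) = q ^ 4 * (q ^ 4) ^ k"
        by (simp only: power_add power_mult)
      finally have "(q\<^sup>2) ^ n = q ^ 4 * (q ^ 4) ^ k" .
      moreover have "fps_nth B (2 * k) = fps_nth B n * (1 - q ^ 4 * (q ^ 4) ^ k)"
        using nz by (simp add: B_def k qpoch_Suc)
      ultimately have "fps_nth (?S B (q\<^sup>2)) n = fps_nth B n - fps_nth B (2 * k)"
        unfolding fps_nth_compose_linear by (simp add: algebra_simps)
      then show ?thesis unfolding * by (simp add: k)
    next
      case False
      then show ?thesis unfolding * by (auto simp: B_def fps_X_mult_nth)
    qed
  qed
  have "(1 + fps_X) * ((1 - fps_X) * (A * B)) = A * ?S B (q\<^sup>2)"
    unfolding B2 by (simp add: mult_ac)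
  also have "\<dots> = (1 + fps_X) * ((1 + fps_const q * fps_X) * ?S (A * B) (q\<^sup>2))"
    by (subst A2) (simp add: fps_compose_mult_distrib mult_ac)
  finally have "(1 - fps_X) * (A * B) = (1 + fps_const q * fps_X) * ?S (A * B) (q\<^sup>2)"
  proof (subst (asm) mult_left_cancel)
    have "fps_nth (1 + fps_X :: complex fps) 0 \<noteq> fps_nth 0 0" by simp
    then show "1 + fps_X \<noteq> (0 :: complex fps)" by auto
  qed
  then have "fps_nth (A * B) N = qpoch (- q) (q\<^sup>2) N / qpoch (q\<^sup>2) (q\<^sup>2) N"
    by (intro fps_q_binomial_nth[OF q]) (simp_all add: A_def B_def)
  also have "fps_nth (A * B) N = (\<Sum>i\<le>N. fps_nth A i * fps_nth B (N - i))"
    by (simp add: fps_mult_nth atLeast0AtMost)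
  also have "\<dots> = (\<Sum>i | i \<le> N \<and> even (N - i). fps_nth A i * fps_nth B (N - i))"
    by (rule sum.mono_neutral_right) (auto simp: B_def)
  also have "\<dots> = (\<Sum>(i, j) \<in> {(i, j). i + 2 * j = N}. q ^ triangle (i - 1) / (qpoch q q i * qpoch (q ^ 4) (q ^ 4) j))"
    by (rule sum.reindex_bij_witness[of _ fst "\<lambda>i. (i, (N - i) div 2)"]) (auto simp: A_def B_def)
  finally show ?thesis .
qed

lemma norm_inverse_qpoch_mult_le:
  assumes q: "norm q < 1"
  obtains K where "\<And>i j. norm (1 / (qpoch q q i * qpoch (q ^ 4) (q ^ 4) j)) \<le> K"
proof -
  have q4: "norm (q ^ 4) < 1" by (intro norm_power_less_one q) simp
  obtain B where B: "B > 0" "\<And>n. norm (inverse (qpoch q q n)) \<le> B"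
    using inverse_qpoch_bounded[OF q q] by blast
  obtain B' where B': "B' > 0" "\<And>n. norm (inverse (qpoch (q ^ 4) (q ^ 4) n)) \<le> B'"
    using inverse_qpoch_bounded[OF q4 q4] by blast
  have "norm (1 / (qpoch q q i * qpoch (q ^ 4) (q ^ 4) j)) \<le> B * B'" for i j
    unfolding divide_inverse norm_mult inverse_mult_distrib
    using mult_mono[OF B(2)[of i] B'(2)[of j]] B(1) by simp
  then show thesis by (rule that)
qed

text \<open>The reciprocals of \<open>(q;q)_i\<close> and \<open>(q\<^sup>4;q\<^sup>4)_j\<close> are bounded, so the terms are dominated by a multiple of
  \<open>|q|^i |q|^j\<close> and the double series converges absolutely. It may then be summed along the
  finite sets \<open>i + 2 j = N\<close>.\<close>

lemma double_sum_eq_single_sum: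
  assumes q: "norm q < 1"
    and w: "\<And>N. norm (w N) \<le> C * norm q ^ N"
    and S: "(\<lambda>N. w N * (qpoch (- q) (q\<^sup>2) N / qpoch (q\<^sup>2) (q\<^sup>2) N)) sums S"
  shows "((\<lambda>(i, j). w (i + 2 * j) * (q ^ triangle (i - 1) / (qpoch q q i * qpoch (q ^ 4) (q ^ 4) j)))
            has_sum S) UNIV"
proof -
  define f where "f = (\<lambda>(i, j). w (i + 2 * j) * (q ^ triangle (i - 1) / (qpoch q q i * qpoch (q ^ 4) (q ^ 4) j)))"
  obtain K where K: "\<And>i j. norm (1 / (qpoch q q i * qpoch (q ^ 4) (q ^ 4) j)) \<le> K"
    using norm_inverse_qpoch_mult_le[OF q] by blast
  have C: "C \<ge> 0" using order_trans[OF norm_ge_zero w[of 0]] by simp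
  have fb: "norm (f (i, j)) \<le> C * K * (norm q ^ i * norm q ^ j)" for i j
  proof -
    have "norm (f (i, j)) = norm (w (i + 2 * j)) * (norm q ^ triangle (i - 1) * norm (1 / (qpoch q q i * qpoch (q ^ 4) (q ^ 4) j)))"
      by (simp add: f_def norm_mult norm_divide norm_power)
    also have "\<dots> \<le> (C * norm q ^ (i + 2 * j)) * (1 * K)"
      using q C by (intro mult_mono w K power_le_one) auto
    also have "\<dots> \<le> (C * norm q ^ (i + j)) * (1 * K)"
      using q C order_trans[OF norm_ge_zero K[of 0 0]] by (intro mult_right_mono mult_left_mono power_decreasing) auto
    finally show ?thesis by (simp add: power_add mult_ac)
  qed
  have geo: "(\<lambda>n. norm q ^ n) summable_on (UNIV :: nat set)"
    using q by (subst summable_on_UNIV_nonneg_real_iff) (auto intro: summable_geometric)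
  have "(\<lambda>(i, j). norm q ^ i * norm q ^ j) summable_on (UNIV \<times> UNIV :: (nat \<times> nat) set)"
  proof (rule summable_on_SigmaI)
    show "((\<lambda>j. case (i, j) of (i, j) \<Rightarrow> norm q ^ i * norm q ^ j) has_sum norm q ^ i * (\<Sum>\<^sub>\<infinity>j. norm q ^ j)) UNIV" for i
      unfolding case_prod_conv by (rule has_sum_cmult_right[OF has_sum_infsum[OF geo]])
  qed (auto intro: summable_on_cmult_left geo)
  then have "(\<lambda>x. C * K * (case x of (i, j) \<Rightarrow> norm q ^ i * norm q ^ j)) summable_on UNIV"
    by (intro summable_on_cmult_right) simp
  then have "(\<lambda>x. norm (f x)) summable_on UNIV"
    by (rule Infinite_Sum.abs_summable_on_comparison_test') (use fb in auto)
  then have "f summable_on UNIV" by (rule abs_summable_summable)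
  then obtain V where V: "(f has_sum V) UNIV" by (auto simp: summable_on_def)
  \<comment> \<open>Tag every pair with the number of its antidiagonal.\<close>
  have "(f has_sum V) UNIV \<longleftrightarrow> ((\<lambda>x. f (snd x)) has_sum V) (SIGMA N:UNIV. {(i, j). i + 2 * j = N})"
    by (rule has_sum_reindex_bij_witness[of _ snd "\<lambda>x. (fst x + 2 * snd x, x)"]) auto
  with V have "((\<lambda>x. f (snd x)) has_sum V) (SIGMA N:UNIV. {(i, j). i + 2 * j = N})"
    by simp
  then have "((\<lambda>N. \<Sum>x\<in>{(i, j). i + 2 * j = N}. f x) has_sum V) UNIV"
  proof (rule has_sum_SigmaD)
    fix N :: nat
    have "{(i, j). i + 2 * j = N} \<subseteq> {..N} \<times> {..N}" by auto
    then have "finite {(i, j). i + 2 * j = N}" by (rule finite_subset) auto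
    then show "((\<lambda>y. f (snd (N, y))) has_sum (\<Sum>x\<in>{(i, j). i + 2 * j = N}. f x)) {(i, j). i + 2 * j = N}"
      by (intro has_sum_finiteI) auto
  qed
  also have "(\<lambda>N. \<Sum>x\<in>{(i, j). i + 2 * j = N}. f x) = (\<lambda>N. w N * (qpoch (- q) (q\<^sup>2) N / qpoch (q\<^sup>2) (q\<^sup>2) N))"
    unfolding antidiagonal_sum[OF q, symmetric] sum_distrib_left f_def by (intro ext sum.cong) auto
  finally have "V = S"
    using S by (intro sums_unique2[OF has_sum_imp_sums])
  then show ?thesis using V by (simp add: f_def)
qed

section \<open>Lebesgue's identity\<close>

text \<open>The bound is uniform in \<open>z\<close>, by \<open>|1 - z p^k| \<le> 1 + |p|^k\<close>; this uniformity lets the limit \<open>y \<rightarrow> 0\<close> be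
  taken inside the series of Lebesgue's identity.\<close>

lemma qpoch_ratio_bounded:
  assumes p: "norm p < 1"
  obtains C where "\<And>z n. norm z \<le> 1 \<Longrightarrow> norm (qpoch z p n / qpoch p p n) \<le> C"
proof -
  obtain B where B: "\<And>n. norm (inverse (qpoch p p n)) \<le> B"
    using inverse_qpoch_bounded[OF p p] by blast
  have "norm (complex_of_real (norm p)) < 1" using p by simp
  then obtain B' where B': "\<And>n. norm (qpoch (- 1) (of_real (norm p)) n) \<le> B'"
    using qpoch_bounded by blast
  have "norm (qpoch z p n) \<le> B'" if "norm z \<le> 1" for z n
  proof -
    have "norm (1 - z * p ^ k) \<le> norm (1 + complex_of_real (norm p) ^ k)" for k
    proof -
      have "norm (1 - z * p ^ k) \<le> 1 + norm z * norm p ^ k"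
        using norm_triangle_ineq4[of 1 "z * p ^ k"] by (simp add: norm_mult norm_power)
      also have "\<dots> \<le> 1 + 1 * norm p ^ k"
        using that by (intro add_left_mono mult_right_mono) auto
      also have "\<dots> = norm (complex_of_real (1 + norm p ^ k))"
        unfolding norm_of_real by simp
      finally show ?thesis by simp
    qed
    then have "norm (qpoch z p n) \<le> norm (qpoch (- 1) (of_real (norm p)) n)"
      unfolding qpoch_def prod_norm[symmetric] by (intro prod_mono) simp
    then show ?thesis using B'[of n] by linarith
  qed
  then have "norm (qpoch z p n / qpoch p p n) \<le> B' * B" if "norm z \<le> 1" for z n
    unfolding divide_inverse norm_mult using that B[of n] order_trans[OF norm_ge_zero B'[of 0]]
    by (intro mult_mono) auto
  then show thesis by (rule that)
qed

lemma summable_q_series: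
  assumes "norm p < 1" "norm z \<le> 1" "r < 1" "\<And>n. norm (u n) \<le> r ^ n"
  shows "summable (\<lambda>n. norm (u n * (qpoch z p n / qpoch p p n)))"
proof -
  obtain C where C: "\<And>z n. norm z \<le> 1 \<Longrightarrow> norm (qpoch z p n / qpoch p p n) \<le> C"
    using qpoch_ratio_bounded[OF assms(1)] by blast
  have r: "0 \<le> r" using order_trans[OF norm_ge_zero assms(4)[of 1]] by simp
  have "norm (u n * (qpoch z p n / qpoch p p n)) \<le> r ^ n * C" for n
    unfolding norm_mult using r by (intro mult_mono assms(4) C assms(2)) auto
  then have "\<exists>N. \<forall>n\<ge>N. norm (norm (u n * (qpoch z p n / qpoch p p n))) \<le> r ^ n * C"
    by simp
  moreover have "summable (\<lambda>n. r ^ n * C)"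
    using r assms(3) by (intro summable_mult2 summable_geometric) auto
  ultimately show ?thesis by (rule summable_comparison_test)
qed

lemma norm_power_le_power:
  "norm p < 1 \<Longrightarrow> n \<le> m \<Longrightarrow> norm (p ^ m :: complex) \<le> norm p ^ n"
  unfolding norm_power by (rule power_decreasing) auto

text \<open>The \<open>q\<close>-Chu-Vandermonde sum with \<open>c = 0\<close> and \<open>e = - p\<close>, in the limit of infinite length.\<close>

lemma euler_distinct_parts:
  assumes p: "norm p < 1"
  shows "(\<Sum>n. p ^ triangle n / qpoch p p n) = qpoch_inf (- p) p"
proof -
  have nz: "qpoch_inf p p \<noteq> 0" by (rule qpoch_inf_nonzero[OF p p])
  have "summable (\<lambda>n. norm (p ^ triangle n * (qpoch 0 p n / qpoch p p n)))"
    by (rule summable_q_series[of _ _ "norm p"]) (use p in \<open>auto intro: norm_power_le_power triangle_ge\<close>)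
  then have "summable (\<lambda>n. norm (p ^ triangle n / qpoch p p n))"
    by (simp add: qpoch_def)
  from qpoch_convolution_LIMSEQ[OF p this]
  have "(\<lambda>M. \<Sum>n\<le>M. p ^ triangle n / qpoch p p n / qpoch p p (M - n))
          \<longlonglongrightarrow> (\<Sum>n. p ^ triangle n / qpoch p p n) / qpoch_inf p p" .
  moreover have "(\<Sum>n\<le>M. p ^ triangle n / qpoch p p n / qpoch p p (M - n)) = qpoch (- p) p M / qpoch p p M" for M
  proof -
    have "vander_weight p 0 (- p) n = p ^ triangle n" for n
      by (induction n) (simp_all add: vander_weight_def power_add mult_ac)
    then show ?thesis
      using q_chu_vandermonde[OF p, of 0 "- p" M] by (simp add: qpoch_def[of 0] mult.commute)
  qed
  moreover have "(\<lambda>M. qpoch (- p) p M / qpoch p p M) \<longlonglongrightarrow> qpoch_inf (- p) p / qpoch_inf p p"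
    by (intro tendsto_intros qpoch_LIMSEQ p nz)
  ultimately have "(\<Sum>n. p ^ triangle n / qpoch p p n) / qpoch_inf p p = qpoch_inf (- p) p / qpoch_inf p p"
    by (intro LIMSEQ_unique) simp_all
  then show ?thesis using nz by simp
qed

text \<open>Let \<open>L(y)\<close> be the sum with \<open>y\<close> in place of \<open>x\<close>, and \<open>K(y)\<close> the same sum with an additional
  factor \<open>p^n\<close>. Comparing terms gives the contiguous relations
  \<open>L(y) - L(y p) = y p K(y p)\<close> and \<open>L(y) + y K(y) = (1 + y) L(y p)\<close>. Eliminating \<open>K\<close> yields
  \<open>L(y) = (1 + y p) L(y p\<^sup>2)\<close>, and iteration reduces \<open>L(x)\<close> to \<open>L(0)\<close>, which is Euler's product.\<close>

theorem lebesgue_identity: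
  assumes p: "norm p < 1" and x: "norm x \<le> 1"
  shows "(\<lambda>n. p ^ triangle n * (qpoch (- x) p n / qpoch p p n)) sums (qpoch_inf (- p) p * qpoch_inf (- x * p) (p\<^sup>2))"
proof -
  define a where "a = (\<lambda>y n. p ^ triangle n * (qpoch (- y) p n / qpoch p p n))"
  define b where "b = (\<lambda>y n. p ^ (triangle n + n) * (qpoch (- y) p n / qpoch p p n))"
  have a: "summable (a y)" and b: "summable (b y)" if "norm y \<le> 1" for y
    unfolding a_def b_def using that p
    by (intro summable_norm_cancel[OF summable_q_series[OF p _ p]] norm_power_le_power triangle_ge trans_le_add1; simp)+
  have p2: "norm (p\<^sup>2) < 1" by (rule norm_power_less_one[OF p pos2])
  have yp: "norm (y * p) \<le> 1" if "norm y \<le> 1" for y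
    using that p mult_mono[of "norm y" 1 "norm p" 1] by (simp add: norm_mult)
  have contiguous1: "suminf (a y) - suminf (a (y * p)) = y * p * suminf (b (y * p))" if y: "norm y \<le> 1" for y
  proof -
    have "a y (Suc n) - a (y * p) (Suc n) = y * p * b (y * p) n" for n
    proof -
      have nz: "1 - p * p ^ n \<noteq> 0" by (rule one_minus_mult_power_nonzero[OF p p])
      have "qpoch (- y) p (Suc n) - qpoch (- (y * p)) p (Suc n) = y * (1 - p * p ^ n) * qpoch (- (y * p)) p n"
        unfolding qpoch_Suc_left[of "- y"] qpoch_Suc[of "- (y * p)"] by (simp add: algebra_simps)
      then have "a y (Suc n) - a (y * p) (Suc n) = p ^ triangle (Suc n) * (y * (1 - p * p ^ n) * qpoch (- (y * p)) p n / qpoch p p (Suc n))"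
        unfolding a_def by (simp only: right_diff_distrib[symmetric] diff_divide_distrib[symmetric])
      then show ?thesis using nz by (simp add: b_def qpoch_Suc power_add)
    qed
    moreover have "a y 0 - a (y * p) 0 = 0" by (simp add: a_def)
    moreover have "suminf (a y) - suminf (a (y * p)) = (\<Sum>n. a y n - a (y * p) n)"
      by (rule suminf_diff[OF a[OF y] a[OF yp[OF y]]])
    moreover have "(\<Sum>n. a y n - a (y * p) n) = (\<Sum>n. a y (Suc n) - a (y * p) (Suc n)) + (a y 0 - a (y * p) 0)"
      using suminf_split_head[OF summable_diff[OF a[OF y] a[OF yp[OF y]]]] by simp
    ultimately show ?thesis
      using suminf_mult[OF b[OF yp[OF y]], of "y * p"] by simp
  qed
  have contiguous2: "suminf (a y) + y * suminf (b y) = (1 + y) * suminf (a (y * p))" if y: "norm y \<le> 1" for y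
  proof -
    have "a y n + y * b y n = (1 + y) * a (y * p) n" for n
    proof -
      have "a y n + y * b y n = p ^ triangle n * (qpoch (- y) p (Suc n) / qpoch p p n)"
        by (simp add: a_def b_def qpoch_Suc power_add algebra_simps add_divide_distrib)
      then show ?thesis by (simp add: a_def qpoch_Suc_left)
    qed
    then have "(\<Sum>n. a y n + y * b y n) = (1 + y) * suminf (a (y * p))"
      using suminf_mult[OF a[OF yp[OF y]]] by simp
    then show ?thesis
      using suminf_add[OF a[OF y] summable_mult[OF b[OF y]]] suminf_mult[OF b[OF y]] by simp
  qed
  have step: "suminf (a y) = (1 + y * p) * suminf (a (y * p\<^sup>2))" if y: "norm y \<le> 1" for y
  proof -
    have "suminf (a y) = suminf (a (y * p)) + y * p * suminf (b (y * p))"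
      using contiguous1[OF y] by (simp only: diff_eq_eq add.commute)
    also note contiguous2[OF yp[OF y]]
    also have "y * p * p = y * p\<^sup>2"
      by (simp add: power2_eq_square)
    finally show ?thesis .
  qed
  have xp: "norm (x * (p\<^sup>2) ^ n) \<le> 1" for n
    using mult_mono[of "norm x" 1 "norm (p\<^sup>2) ^ n" 1] x p2 by (simp add: norm_mult norm_power power_le_one)
  \<comment> \<open>Iterating removes the factors \<open>1 + x p^(2k+1)\<close>, which form \<open>(- x p;p\<^sup>2)_n\<close>.\<close>
  have iter: "suminf (a x) = qpoch (- x * p) (p\<^sup>2) n * suminf (a (x * (p\<^sup>2) ^ n))" for n
  proof (induction n)
    case (Suc n)
    then show ?case using step[OF xp[of n]] by (simp add: qpoch_Suc mult_ac)
  qed simp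
  have "(\<lambda>n. suminf (a (x * (p\<^sup>2) ^ n))) \<longlonglongrightarrow> suminf (a 0)"
  proof -
    obtain C where C: "\<And>z n. norm z \<le> 1 \<Longrightarrow> norm (qpoch z p n / qpoch p p n) \<le> C"
      using qpoch_ratio_bounded[OF p] by blast
    define z where "z = (\<lambda>n. x * (p\<^sup>2) ^ n)"
    have "z \<longlonglongrightarrow> x * 0"
      unfolding z_def by (intro tendsto_intros LIMSEQ_power_zero p2)
    then have z: "z \<longlonglongrightarrow> 0" by simp
    have nz: "(\<Prod>i<k. 1 - p * p ^ i) \<noteq> 0" for k
      using qpoch_nonzero[OF p p, of k] by (simp only: qpoch_def not_False_eq_True)
    have "(\<lambda>n. a (z n) k) \<longlonglongrightarrow> a 0 k" for k
      unfolding a_def qpoch_def by (intro tendsto_intros z nz)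
    then have "(\<lambda>n. a (x * (p\<^sup>2) ^ n) k) \<longlonglongrightarrow> a 0 k" for k
      by (simp add: z_def)
    moreover have "norm (a (x * (p\<^sup>2) ^ n) k) \<le> norm p ^ k * C" for k n
      unfolding a_def norm_mult[of "_ ^ _"]
      using C[of "- (x * (p\<^sup>2) ^ n)" k] xp[of n] p by (intro mult_mono norm_power_le_power triangle_ge) auto
    moreover have "summable (\<lambda>k. norm p ^ k * C)"
      using p by (intro summable_mult2 summable_geometric) auto
    ultimately show ?thesis
      using tannerys_theorem[of "\<lambda>k n. a (x * (p\<^sup>2) ^ n) k" "a 0" sequentially "\<lambda>k. norm p ^ k * C", OF _ always_eventually]
      by auto
  qed
  then have "(\<lambda>n. qpoch (- x * p) (p\<^sup>2) n * suminf (a (x * (p\<^sup>2) ^ n))) \<longlonglongrightarrow> qpoch_inf (- x * p) (p\<^sup>2) * suminf (a 0)"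
    by (intro tendsto_mult qpoch_LIMSEQ p2)
  then have "suminf (a x) = qpoch_inf (- x * p) (p\<^sup>2) * suminf (a 0)"
    unfolding iter[symmetric] by (simp add: LIMSEQ_const_iff)
  moreover have "suminf (a 0) = qpoch_inf (- p) p"
    using euler_distinct_parts[OF p] by (simp add: a_def qpoch_def[of 0])
  ultimately show ?thesis
    using summable_sums[OF a[OF x]] by (simp add: a_def mult.commute)
qed

section \<open>Theta series of the Goellnitz-Gordon identities\<close>

lemma triangle_rec: "triangle r = r + triangle (r - 1)"
  by (cases r) auto

lemma square_eq_triangle: "n\<^sup>2 = n + 2 * triangle (n - 1)"
proof (induction n)
  case (Suc n)
  then show ?case using triangle_rec[of n] by (simp add: power2_eq_square)
qed simp

text \<open>With \<open>p = q\<^sup>2\<close>, \<open>d = - q\<close> and \<open>e = - q\<close> or \<open>e = - q\<^sup>3\<close> this is \<open>q^(n\<^sup>2) (-q;q\<^sup>2)_n\<close> or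
  \<open>q^(n\<^sup>2+2n) (-q;q\<^sup>2)_n\<close>, and \<open>e d\<close> is \<open>p\<close> or \<open>p\<^sup>2\<close> as Bailey's lemma with \<open>s = 0\<close> or \<open>s = 1\<close> requires.\<close>

lemma vander_weight_factor:
  "vander_weight p (e * d) e n = (- e) ^ n * p ^ triangle (n - 1) * qpoch d p n"
proof (induction n)
  case (Suc n)
  then show ?case using triangle_rec[of n]
    by (simp add: vander_weight_def qpoch_Suc power_add algebra_simps)
qed simp

lemma vander_weight_zero: "vander_weight p c 0 n = c ^ n * p ^ (2 * triangle (n - 1))"
proof (induction n)
  case (Suc n)
  have "p ^ (2 * triangle n) = p ^ n * p ^ n * p ^ (2 * triangle (n - 1))"
    by (subst triangle_rec) (simp only: distrib_left mult_2 power_add)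
  then show ?case using Suc
    by (simp add: vander_weight_def)
qed simp

lemma theta_term_power:
  "theta_term (q ^ a) (q ^ b) r = (-1) ^ r * q ^ (a * r + (a + b) * triangle (r - 1))"
  unfolding theta_term_def triangle_rec[of r]
  by (simp add: power_mult[symmetric] power_add[symmetric] algebra_simps)

text \<open>For \<open>w = - q\<close> the factor \<open>(w;p)_r\<close> cancels completely in the second Bailey step, so the exponents
  just add up: \<open>r\<^sup>2 + 2 r\<^sup>2 + r (r \<mp> 1)\<close> is the exponent \<open>4 r\<^sup>2 \<mp> r\<close> of the theta series with
  \<open>x = q\<^sup>3\<close>, \<open>y = q\<^sup>5\<close>.\<close>

lemma goellnitz_gordon_sum_0:
  assumes q: "norm q < 1"
  shows "(\<lambda>n. q ^ (n\<^sup>2) * (qpoch (- q) (q\<^sup>2) n / qpoch (q\<^sup>2) (q\<^sup>2) n)) sums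
    (qpoch_inf (- q) (q\<^sup>2) / qpoch_inf (q\<^sup>2) (q\<^sup>2)
       * (qpoch_inf (q ^ 3) (q ^ 8) * qpoch_inf (q ^ 5) (q ^ 8) * qpoch_inf (q ^ 8) (q ^ 8)))"
proof -
  have p: "norm (q\<^sup>2) < 1" by (rule norm_power_less_one[OF q pos2])
  let ?\<delta> = "vander_weight (q\<^sup>2) ((q\<^sup>2) ^ Suc 0)"
  have \<delta>: "?\<delta> (- q) n = q ^ (n\<^sup>2) * qpoch (- q) (q\<^sup>2) n" for n
    using vander_weight_factor[of "q\<^sup>2" "- q" "- q" n]
    by (simp add: square_eq_triangle power_add power_mult power2_eq_square)
  have \<delta>': "?\<delta> (- q) n / qpoch (q\<^sup>2) (q\<^sup>2) n = q ^ (n\<^sup>2) * (qpoch (- q) (q\<^sup>2) n / qpoch (q\<^sup>2) (q\<^sup>2) n)" for n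
    by (simp only: \<delta> times_divide_eq_right)
  have \<alpha>: "?\<delta> (- q) r / qpoch (- q) (q\<^sup>2) r * (?\<delta> 0 r * theta_pair 1 (q\<^sup>2) 0 r) = theta_pair (q ^ 3) (q ^ 5) 0 r" for r
  proof (cases "r = 0")
    case False
    have t: "theta_term 1 (q\<^sup>2) r = (-1) ^ r * q ^ (2 * triangle (r - 1))"
      "theta_term (q\<^sup>2) 1 r = (-1) ^ r * q ^ (2 * r + 2 * triangle (r - 1))"
      using theta_term_power[of q 0 2 r] theta_term_power[of q 2 0 r] by (simp_all add: mult_2)
    have "qpoch (- q) (q\<^sup>2) r \<noteq> 0" using q p by (intro qpoch_nonzero) auto
    then have "?\<delta> (- q) r / qpoch (- q) (q\<^sup>2) r = q ^ (r\<^sup>2)"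
      unfolding \<delta> by (rule nonzero_mult_div_cancel_right)
    moreover have "q ^ (r\<^sup>2) * (?\<delta> 0 r * theta_pair 1 (q\<^sup>2) 0 r) = theta_pair (q ^ 3) (q ^ 5) 0 r"
      using False
      unfolding vander_weight_zero theta_pair_def add_0_right t theta_term_power square_eq_triangle
      by (simp add: power_mult[symmetric] power_add[symmetric] distrib_left mult_ac)
         (simp add: algebra_simps)
    ultimately show ?thesis by (simp only:)
  qed (simp add: theta_pair_def)
  have s\<alpha>: "summable (\<lambda>r. norm (theta_pair (q ^ 3) (q ^ 5) 0 r))"
    using q by (intro summable_theta_pair) (simp_all add: norm_mult norm_power power_le_one power_add[symmetric] power_less_one_iff)
  have s\<beta>: "summable (\<lambda>n. norm (q ^ (n\<^sup>2) * (qpoch (- q) (q\<^sup>2) n / qpoch (q\<^sup>2) (q\<^sup>2) n)))"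
    using q p by (intro summable_q_series[of _ _ "norm q"] norm_power_le_power) (auto simp: power2_eq_square)
  have q8: "norm (q ^ 8) < 1" by (intro norm_power_less_one q) simp
  have "suminf (theta_pair (q ^ 3) (q ^ 5) 0) = qpoch_inf (q ^ 3) (q ^ 8) * qpoch_inf (q ^ 5) (q ^ 8) * qpoch_inf (q ^ 8) (q ^ 8)"
    using q by (intro jacobi_triple_product q8) (simp_all add: norm_power power_le_one power_add[symmetric])
  moreover have "(\<Sum>n. q ^ (n\<^sup>2) * (qpoch (- q) (q\<^sup>2) n / qpoch (q\<^sup>2) (q\<^sup>2) n))
     = qpoch_inf (- q) (q\<^sup>2) / qpoch_inf (q\<^sup>2) (q\<^sup>2) * suminf (theta_pair (q ^ 3) (q ^ 5) 0)"
    using bailey_slater_sum[of "q\<^sup>2" "- q" 0, unfolded \<alpha> \<delta>'] q p s\<alpha> s\<beta> by simp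
  ultimately have "(\<Sum>n. q ^ (n\<^sup>2) * (qpoch (- q) (q\<^sup>2) n / qpoch (q\<^sup>2) (q\<^sup>2) n))
     = qpoch_inf (- q) (q\<^sup>2) / qpoch_inf (q\<^sup>2) (q\<^sup>2)
         * (qpoch_inf (q ^ 3) (q ^ 8) * qpoch_inf (q ^ 5) (q ^ 8) * qpoch_inf (q ^ 8) (q ^ 8))"
    by metis
  with summable_sums[OF summable_norm_cancel[OF s\<beta>]] show ?thesis
    by (rule back_subst)
qed

text \<open>Here \<open>(-q;q\<^sup>2)_r / (-q\<^sup>3;q\<^sup>2)_r = (1 + q) / (1 + Q)\<close> with \<open>Q = q^(2r+1)\<close>. The denominator cancels against the
  factor \<open>1 - Q\<^sup>2\<close> of the theta pair for \<open>x = 1\<close>, \<open>y = q\<^sup>2\<close> and leaves the factor \<open>1 - Q\<close> of the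
  theta pair for \<open>x = q\<^sup>7\<close>, \<open>y = q\<close>.\<close>

lemma goellnitz_gordon_sum_1:
  assumes q: "norm q < 1"
  shows "(\<lambda>n. q ^ (n\<^sup>2 + 2 * n) * (qpoch (- q) (q\<^sup>2) n / qpoch (q\<^sup>2) (q\<^sup>2) n)) sums
    (qpoch_inf (- q) (q\<^sup>2) / qpoch_inf (q\<^sup>2) (q\<^sup>2)
       * (qpoch_inf (q ^ 7) (q ^ 8) * qpoch_inf q (q ^ 8) * qpoch_inf (q ^ 8) (q ^ 8)))"
proof -
  have p: "norm (q\<^sup>2) < 1" by (rule norm_power_less_one[OF q pos2])
  have q3: "norm (q ^ 3) < 1" by (intro norm_power_less_one q) simp
  let ?\<delta> = "vander_weight (q\<^sup>2) ((q\<^sup>2) ^ Suc 1)"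
  have \<delta>: "?\<delta> (- (q ^ 3)) n = q ^ (n\<^sup>2 + 2 * n) * qpoch (- q) (q\<^sup>2) n" for n
  proof -
    have "(q ^ 3) ^ n * (q\<^sup>2) ^ triangle (n - 1) = q ^ (n\<^sup>2 + 2 * n)"
      unfolding square_eq_triangle by (simp add: power_mult[symmetric] power_add[symmetric] algebra_simps)
    moreover have "(q\<^sup>2) ^ Suc 1 = - (q ^ 3) * - q" by (simp add: eval_nat_numeral)
    ultimately show ?thesis
      using vander_weight_factor[of "q\<^sup>2" "- (q ^ 3)" "- q" n] by simp
  qed
  have \<delta>': "?\<delta> (- (q ^ 3)) n / qpoch (q\<^sup>2) (q\<^sup>2) n = q ^ (n\<^sup>2 + 2 * n) * (qpoch (- q) (q\<^sup>2) n / qpoch (q\<^sup>2) (q\<^sup>2) n)" for n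
    by (simp only: \<delta> times_divide_eq_right)
  have \<alpha>: "?\<delta> (- (q ^ 3)) r / qpoch (- (q ^ 3)) (q\<^sup>2) r * (?\<delta> 0 r * theta_pair 1 (q\<^sup>2) 1 r)
      = (1 + q) * theta_pair (q ^ 7) q 1 r" for r
  proof -
    define Q where "Q = q ^ (2 * r + 1)"
    define t where "t = triangle (r - 1)"
    have Q: "1 + Q \<noteq> 0"
      using one_minus_mult_power_nonzero[of "q\<^sup>2" "- q" r] q p by (simp add: Q_def power_mult)
    have nz: "qpoch (- (q ^ 3)) (q\<^sup>2) r \<noteq> 0" using q3 p by (intro qpoch_nonzero) auto
    have "qpoch (- q) (q\<^sup>2) r * (1 + Q) = (1 + q) * qpoch (- (q ^ 3)) (q\<^sup>2) r"
    proof -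
      have "- q * q\<^sup>2 = - (q ^ 3)" "Q = q * (q\<^sup>2) ^ r"
        by (simp add: eval_nat_numeral, simp add: Q_def power_mult)
      then show ?thesis
        using qpoch_Suc[of "- q" "q\<^sup>2" r] qpoch_Suc_left[of "- q" "q\<^sup>2" r] by simp
    qed
    then have ratio: "qpoch (- q) (q\<^sup>2) r / qpoch (- (q ^ 3)) (q\<^sup>2) r = (1 + q) / (1 + Q)"
      using Q nz by (simp add: field_simps)
    have t1: "theta_pair 1 (q\<^sup>2) 1 r = (-1) ^ r * q ^ (2 * t) * (1 - Q\<^sup>2)"
      using theta_term_power[of q 0 2 r] theta_term_power[of q 2 0 r]
      by (simp add: theta_pair_def theta_term_Suc t_def Q_def power_mult[symmetric] power_add[symmetric] algebra_simps)
         (simp add: power_add power_mult power2_eq_square mult_ac power_mult_distrib)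
    have t2: "theta_pair (q ^ 7) q 1 r = (-1) ^ r * q ^ (7 * r + 8 * t) * (1 - Q)"
      using theta_term_power[of q 7 1 r] theta_term_power[of q 1 7 r]
      by (simp add: theta_pair_def theta_term_Suc t_def Q_def power_mult[symmetric] power_add[symmetric] algebra_simps)
    have "q ^ (r\<^sup>2 + 2 * r) * (((q\<^sup>2) ^ Suc 1) ^ r * (q\<^sup>2) ^ (2 * t)) * q ^ (2 * t) = q ^ (7 * r + 8 * t)"
      unfolding square_eq_triangle[of r] t_def[symmetric]
      by (simp add: power_mult[symmetric] power_add[symmetric] algebra_simps)
    moreover have "(1 + q) / (1 + Q) * (1 - Q\<^sup>2) = (1 + q) * (1 - Q)"
      using Q by (simp add: field_simps power2_eq_square)
    moreover have "?\<delta> (- (q ^ 3)) r / qpoch (- (q ^ 3)) (q\<^sup>2) r * (?\<delta> 0 r * theta_pair 1 (q\<^sup>2) 1 r)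
       = (-1) ^ r * (q ^ (r\<^sup>2 + 2 * r) * (((q\<^sup>2) ^ Suc 1) ^ r * (q\<^sup>2) ^ (2 * t)) * q ^ (2 * t)) * ((1 + q) / (1 + Q) * (1 - Q\<^sup>2))"
      unfolding \<delta> vander_weight_zero t1 ratio[symmetric] t_def by simp
    ultimately show ?thesis
      unfolding t2 by simp
  qed
  have s\<theta>: "summable (\<lambda>r. norm (theta_pair (q ^ 7) q 1 r))"
    using q by (intro summable_theta_pair) (simp_all add: norm_mult norm_power power_le_one power_Suc2[symmetric] power_less_one_iff del: power_Suc)
  then have s\<alpha>: "summable (\<lambda>r. norm ((1 + q) * theta_pair (q ^ 7) q 1 r))"
    unfolding norm_mult by (rule summable_mult)
  have s\<beta>: "summable (\<lambda>n. norm (q ^ (n\<^sup>2 + 2 * n) * (qpoch (- q) (q\<^sup>2) n / qpoch (q\<^sup>2) (q\<^sup>2) n)))"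
    using q p by (intro summable_q_series[of _ _ "norm q"] norm_power_le_power) auto
  have q8: "norm (q ^ 8) < 1" by (intro norm_power_less_one q) simp
  have "suminf (theta_pair (q ^ 7) q 1) = qpoch_inf (q ^ 7) (q ^ 8) * qpoch_inf q (q ^ 8) * qpoch_inf (q ^ 8) (q ^ 8)"
    using q by (intro jacobi_triple_product q8) (simp_all add: norm_power power_le_one power_Suc2[symmetric] del: power_Suc)
  moreover have "(\<Sum>n. q ^ (n\<^sup>2 + 2 * n) * (qpoch (- q) (q\<^sup>2) n / qpoch (q\<^sup>2) (q\<^sup>2) n))
     = qpoch_inf (- (q ^ 3)) (q\<^sup>2) / qpoch_inf (q\<^sup>2) (q\<^sup>2) * (\<Sum>r. (1 + q) * theta_pair (q ^ 7) q 1 r)"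
    using bailey_slater_sum[of "q\<^sup>2" "- (q ^ 3)" 1, unfolded \<alpha> \<delta>'] q3 p s\<alpha> s\<beta> by simp
  moreover have "(\<Sum>r. (1 + q) * theta_pair (q ^ 7) q 1 r) = (1 + q) * suminf (theta_pair (q ^ 7) q 1)"
    by (rule suminf_mult[OF summable_norm_cancel[OF s\<theta>]])
  moreover have "qpoch_inf (- q) (q\<^sup>2) = (1 + q) * qpoch_inf (- (q ^ 3)) (q\<^sup>2)"
    using qpoch_inf_shift[OF p, of "- q"] by (simp add: eval_nat_numeral)
  ultimately have "(\<Sum>n. q ^ (n\<^sup>2 + 2 * n) * (qpoch (- q) (q\<^sup>2) n / qpoch (q\<^sup>2) (q\<^sup>2) n))
     = qpoch_inf (- q) (q\<^sup>2) / qpoch_inf (q\<^sup>2) (q\<^sup>2)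
         * (qpoch_inf (q ^ 7) (q ^ 8) * qpoch_inf q (q ^ 8) * qpoch_inf (q ^ 8) (q ^ 8))"
    by (simp only: times_divide_eq_left times_divide_eq_right mult_ac)
  with summable_sums[OF summable_norm_cancel[OF s\<beta>]] show ?thesis
    by (rule back_subst)
qed

section \<open>Infinite products modulo 8\<close>

definition mod8_product :: "complex \<Rightarrow> nat \<Rightarrow> complex" where
  "mod8_product q a = qpoch_inf (q ^ a) (q ^ 8)"

lemma mod8_product_nonzero: "norm q < 1 \<Longrightarrow> a > 0 \<Longrightarrow> mod8_product q a \<noteq> 0"
  unfolding mod8_product_def by (intro qpoch_inf_nonzero norm_power_less_one) auto

lemma qpoch_inf_bisect_power:
  assumes q: "norm q < 1" and n: "n > 0" and c: "c = a + n" and m: "m = n * 2"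
  shows "qpoch_inf (q ^ a) (q ^ n) = qpoch_inf (q ^ a) (q ^ m) * qpoch_inf (q ^ c) (q ^ m)"
  unfolding c m power_add power_mult by (rule qpoch_inf_bisect[OF norm_power_less_one[OF q n]])

lemma qpoch_inf_mult_uminus_power:
  assumes q: "norm q < 1" and n: "n > 0" and c: "c = a * 2" and m: "m = n * 2"
  shows "qpoch_inf (q ^ a) (q ^ n) * qpoch_inf (- (q ^ a)) (q ^ n) = qpoch_inf (q ^ c) (q ^ m)"
  unfolding c m power_mult by (rule qpoch_inf_mult_uminus[OF norm_power_less_one[OF q n]])

lemma qpoch_inf_mod8:
  assumes q: "norm q < 1"
  shows "qpoch_inf (q ^ 4) (q ^ 4) = mod8_product q 4 * mod8_product q 8"
    and "qpoch_inf q (q ^ 4) = mod8_product q 1 * mod8_product q 5"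
    and "qpoch_inf (q\<^sup>2) (q ^ 4) = mod8_product q 2 * mod8_product q 6"
    and "qpoch_inf (q ^ 3) (q ^ 4) = mod8_product q 3 * mod8_product q 7"
    and "qpoch_inf q (q\<^sup>2) = mod8_product q 1 * mod8_product q 3 * mod8_product q 5 * mod8_product q 7"
    and "qpoch_inf (q\<^sup>2) (q\<^sup>2) = mod8_product q 2 * mod8_product q 4 * mod8_product q 6 * mod8_product q 8"
proof -
  note b = qpoch_inf_bisect_power[OF q]
  have e44: "qpoch_inf (q ^ 4) (q ^ 4) = qpoch_inf (q ^ 4) (q ^ 8) * qpoch_inf (q ^ 8) (q ^ 8)"
    by (rule b) simp_all
  have e41: "qpoch_inf (q ^ 1) (q ^ 4) = qpoch_inf (q ^ 1) (q ^ 8) * qpoch_inf (q ^ 5) (q ^ 8)"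
    by (rule b) simp_all
  have e42: "qpoch_inf (q ^ 2) (q ^ 4) = qpoch_inf (q ^ 2) (q ^ 8) * qpoch_inf (q ^ 6) (q ^ 8)"
    by (rule b) simp_all
  have e43: "qpoch_inf (q ^ 3) (q ^ 4) = qpoch_inf (q ^ 3) (q ^ 8) * qpoch_inf (q ^ 7) (q ^ 8)"
    by (rule b) simp_all
  have e21: "qpoch_inf (q ^ 1) (q ^ 2) = qpoch_inf (q ^ 1) (q ^ 4) * qpoch_inf (q ^ 3) (q ^ 4)"
    by (rule b) simp_all
  have e22: "qpoch_inf (q ^ 2) (q ^ 2) = qpoch_inf (q ^ 2) (q ^ 4) * qpoch_inf (q ^ 4) (q ^ 4)"
    by (rule b) simp_all
  show s44: "qpoch_inf (q ^ 4) (q ^ 4) = mod8_product q 4 * mod8_product q 8"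
    and s14: "qpoch_inf q (q ^ 4) = mod8_product q 1 * mod8_product q 5"
    and s24: "qpoch_inf (q\<^sup>2) (q ^ 4) = mod8_product q 2 * mod8_product q 6"
    and s34: "qpoch_inf (q ^ 3) (q ^ 4) = mod8_product q 3 * mod8_product q 7"
    using e44 e41 e42 e43 by (simp_all only: mod8_product_def power_one_right)
  show "qpoch_inf q (q\<^sup>2) = mod8_product q 1 * mod8_product q 3 * mod8_product q 5 * mod8_product q 7"
    using e21 s14 s34 by (simp only: power_one_right mult_ac)
  show "qpoch_inf (q\<^sup>2) (q\<^sup>2) = mod8_product q 2 * mod8_product q 4 * mod8_product q 6 * mod8_product q 8"
    using e22 s24 s44 by (simp only: mult_ac)
qed

lemma qpoch_inf_uminus_mod8:
  assumes q: "norm q < 1"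
  shows goellnitz_gordon_prefactor: "qpoch_inf (- q) (q\<^sup>2) / qpoch_inf (q\<^sup>2) (q\<^sup>2) = 1 /
      (mod8_product q 1 * mod8_product q 3 * mod8_product q 4 * mod8_product q 5 * mod8_product q 7 * mod8_product q 8)"
    and qpoch_inf_minus_q2_q2: "qpoch_inf (- (q\<^sup>2)) (q\<^sup>2) = 1 / (mod8_product q 2 * mod8_product q 6)"
    and qpoch_inf_minus_q1_q4: "qpoch_inf (- q) (q ^ 4) = mod8_product q 2 / (mod8_product q 1 * mod8_product q 5)"
    and qpoch_inf_minus_q3_q4: "qpoch_inf (- (q ^ 3)) (q ^ 4) = mod8_product q 6 / (mod8_product q 3 * mod8_product q 7)"
proof -
  note prods = qpoch_inf_mod8[OF q]
  have nz: "mod8_product q 1 \<noteq> 0" "mod8_product q 2 \<noteq> 0" "mod8_product q 3 \<noteq> 0" "mod8_product q 4 \<noteq> 0"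
    "mod8_product q 5 \<noteq> 0" "mod8_product q 6 \<noteq> 0" "mod8_product q 7 \<noteq> 0" "mod8_product q 8 \<noteq> 0"
    by (rule mod8_product_nonzero[OF q]; simp)+
  have divideI: "y = z / x" if "x * y = z" "x \<noteq> 0" for x y z :: complex
    using that by auto
  have cancel1: "b * f / (a * c * e * g) / (b * d * f * h) = 1 / (a * c * d * e * g * h)"
    if "b \<noteq> 0" "f \<noteq> 0" for a b c d e f g h :: complex
  proof -
    have eq: "a * c * e * g * (b * d * f * h) = (a * c * d * e * g * h) * (b * f)"
      by (simp only: mult_ac)
    have "b * f \<noteq> 0" using that by simp
    then show ?thesis
      unfolding divide_divide_eq_left eq by (rule nonzero_divide_mult_cancel_right)
  qed
  have cancel2: "d * h / (b * d * f * h) = 1 / (b * f)"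
    if "d \<noteq> 0" "h \<noteq> 0" for b d f h :: complex
  proof -
    have eq: "b * d * f * h = (b * f) * (d * h)"
      by (simp only: mult_ac)
    have "d * h \<noteq> 0" using that by simp
    then show ?thesis
      unfolding eq by (rule nonzero_divide_mult_cancel_right)
  qed
  note sq = qpoch_inf_mult_uminus_power[OF q]
  have "qpoch_inf q (q\<^sup>2) * qpoch_inf (- q) (q\<^sup>2) = mod8_product q 2 * mod8_product q 6"
    unfolding prods(3)[symmetric] by (rule sq[where a = 1, unfolded power_one_right]) simp_all
  then have A: "qpoch_inf (- q) (q\<^sup>2) = mod8_product q 2 * mod8_product q 6 / qpoch_inf q (q\<^sup>2)"
    by (rule divideI) (simp only: prods nz mult_eq_0_iff, simp)
  show "qpoch_inf (- q) (q\<^sup>2) / qpoch_inf (q\<^sup>2) (q\<^sup>2) = 1 /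
      (mod8_product q 1 * mod8_product q 3 * mod8_product q 4 * mod8_product q 5 * mod8_product q 7 * mod8_product q 8)"
    unfolding A prods(5,6) by (rule cancel1[OF nz(2,6)])
  have "qpoch_inf (q\<^sup>2) (q\<^sup>2) * qpoch_inf (- (q\<^sup>2)) (q\<^sup>2) = mod8_product q 4 * mod8_product q 8"
    unfolding prods(1)[symmetric] by (rule sq) simp_all
  then have B: "qpoch_inf (- (q\<^sup>2)) (q\<^sup>2) = mod8_product q 4 * mod8_product q 8 / qpoch_inf (q\<^sup>2) (q\<^sup>2)"
    by (rule divideI) (simp only: prods nz mult_eq_0_iff, simp)
  show "qpoch_inf (- (q\<^sup>2)) (q\<^sup>2) = 1 / (mod8_product q 2 * mod8_product q 6)"
    unfolding B prods(6) by (rule cancel2[OF nz(4,8)])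
  have "qpoch_inf q (q ^ 4) * qpoch_inf (- q) (q ^ 4) = mod8_product q 2"
    unfolding mod8_product_def by (rule sq[where a = 1, unfolded power_one_right]) simp_all
  then have "qpoch_inf (- q) (q ^ 4) = mod8_product q 2 / qpoch_inf q (q ^ 4)"
    by (rule divideI) (simp only: prods nz mult_eq_0_iff, simp)
  then show "qpoch_inf (- q) (q ^ 4) = mod8_product q 2 / (mod8_product q 1 * mod8_product q 5)"
    by (simp only: prods)
  have "qpoch_inf (q ^ 3) (q ^ 4) * qpoch_inf (- (q ^ 3)) (q ^ 4) = mod8_product q 6"
    unfolding mod8_product_def by (rule sq) simp_all
  then have "qpoch_inf (- (q ^ 3)) (q ^ 4) = mod8_product q 6 / qpoch_inf (q ^ 3) (q ^ 4)"
    by (rule divideI) (simp only: prods nz mult_eq_0_iff, simp)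
  then show "qpoch_inf (- (q ^ 3)) (q ^ 4) = mod8_product q 6 / (mod8_product q 3 * mod8_product q 7)"
    by (simp only: prods)
qed

section \<open>The four single sums\<close>

lemma qpochs_inf_mod8: "qpochs_inf [q ^ a, q ^ b, q ^ c] (q ^ 8) = mod8_product q a * mod8_product q b * mod8_product q c"
  by (simp add: qpochs_inf_def mod8_product_def mult.assoc)

text \<open>Lebesgue's identity in base \<open>q\<^sup>2\<close> with \<open>x = q\<close> for the sum without the extra factor. For the other one
  \<open>(1 + q^(2n+1)) (-q;q\<^sup>2)_n = (1 + q) (-q\<^sup>3;q\<^sup>2)_n\<close> leads to \<open>x = q\<^sup>3\<close>.\<close>

lemma little_goellnitz_sums:
  assumes q: "norm q < 1"
  shows little_goellnitz_second: "(\<lambda>n. q ^ (n\<^sup>2 + n) * (qpoch (- q) (q\<^sup>2) n / qpoch (q\<^sup>2) (q\<^sup>2) n)) sums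
            (1 / qpochs_inf [q\<^sup>2, q ^ 3, q ^ 7] (q ^ 8))" (is ?second)
    and little_goellnitz_first: "(\<lambda>n. q ^ (n\<^sup>2 + n) * (1 + q ^ (2 * n + 1)) * (qpoch (- q) (q\<^sup>2) n / qpoch (q\<^sup>2) (q\<^sup>2) n)) sums
            (1 / qpochs_inf [q, q ^ 5, q ^ 6] (q ^ 8))" (is ?first)
proof -
  have p: "norm (q\<^sup>2) < 1" by (rule norm_power_less_one[OF q pos2])
  have q3: "norm (q ^ 3) \<le> 1" using norm_power_less_one[OF q, of 3] by simp
  have nz: "mod8_product q 2 \<noteq> 0" "mod8_product q 6 \<noteq> 0"
    by (rule mod8_product_nonzero[OF q]; simp)+
  have exps: "(q\<^sup>2) ^ triangle n = q ^ (n\<^sup>2 + n)" for n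
  proof -
    have "2 * triangle n = n\<^sup>2 + n"
      unfolding square_eq_triangle by (subst triangle_rec) simp
    then show ?thesis by (simp only: power_mult[symmetric])
  qed
  have q4: "(q\<^sup>2)\<^sup>2 = q ^ 4" and q33: "- q * q\<^sup>2 = - (q ^ 3)"
    by (simp_all add: power_mult[symmetric] eval_nat_numeral)
  have cancel: "1 / (b * f) * (f / (c * g)) = 1 / (b * c * g)" if "f \<noteq> 0" for b c f g :: complex
  proof -
    have "1 / (b * f) * (f / (c * g)) = f / (b * c * g * f)"
      by (simp only: times_divide_times_eq mult_ac mult_1)
    also have "\<dots> = 1 / (b * c * g)"
      by (rule nonzero_divide_mult_cancel_right[OF that])
    finally show ?thesis .
  qed
  show ?second
  proof -
    have "(\<lambda>n. q ^ (n\<^sup>2 + n) * (qpoch (- q) (q\<^sup>2) n / qpoch (q\<^sup>2) (q\<^sup>2) n)) sums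
        (qpoch_inf (- (q\<^sup>2)) (q\<^sup>2) * qpoch_inf (- (q ^ 3)) (q ^ 4))"
      using lebesgue_identity[OF p, of q] q unfolding exps q4 q33 by simp
    also have "qpoch_inf (- (q\<^sup>2)) (q\<^sup>2) * qpoch_inf (- (q ^ 3)) (q ^ 4) = 1 / qpochs_inf [q\<^sup>2, q ^ 3, q ^ 7] (q ^ 8)"
      unfolding qpoch_inf_minus_q2_q2[OF q] qpoch_inf_minus_q3_q4[OF q] qpochs_inf_mod8
      by (rule cancel[OF nz(2)])
    finally show ?thesis .
  qed
  show ?first
  proof -
    have q5: "- (q ^ 3) * q\<^sup>2 = - q * q ^ 4"
      by (simp add: eval_nat_numeral)
    have shift: "q ^ (n\<^sup>2 + n) * (1 + q ^ (2 * n + 1)) * (qpoch (- q) (q\<^sup>2) n / qpoch (q\<^sup>2) (q\<^sup>2) n)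
        = (1 + q) * (q ^ (n\<^sup>2 + n) * (qpoch (- (q ^ 3)) (q\<^sup>2) n / qpoch (q\<^sup>2) (q\<^sup>2) n))" for n
    proof -
      have "(1 + q ^ (2 * n + 1)) * qpoch (- q) (q\<^sup>2) n = (1 + q) * qpoch (- (q ^ 3)) (q\<^sup>2) n"
      proof -
        have "q ^ (2 * n + 1) = q * (q\<^sup>2) ^ n"
          by (simp add: power_mult)
        then show ?thesis
          using qpoch_Suc[of "- q" "q\<^sup>2" n] qpoch_Suc_left[of "- q" "q\<^sup>2" n, unfolded q33]
          by (simp only: mult.commute[of "1 + _"] diff_minus_eq_add mult_minus_left)
      qed
      then show ?thesis
        by (simp only: times_divide_eq_right mult.assoc mult.left_commute[of "1 + q"])
    qed
    have "(\<lambda>n. q ^ (n\<^sup>2 + n) * (qpoch (- (q ^ 3)) (q\<^sup>2) n / qpoch (q\<^sup>2) (q\<^sup>2) n)) sums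
        (qpoch_inf (- (q\<^sup>2)) (q\<^sup>2) * qpoch_inf (- q * q ^ 4) (q ^ 4))"
      using lebesgue_identity[OF p q3] unfolding exps q4 q5 .
    from sums_mult[OF this, of "1 + q"]
    have "(\<lambda>n. q ^ (n\<^sup>2 + n) * (1 + q ^ (2 * n + 1)) * (qpoch (- q) (q\<^sup>2) n / qpoch (q\<^sup>2) (q\<^sup>2) n)) sums
        ((1 + q) * (qpoch_inf (- (q\<^sup>2)) (q\<^sup>2) * qpoch_inf (- q * q ^ 4) (q ^ 4)))"
      unfolding shift .
    also have "(1 + q) * (qpoch_inf (- (q\<^sup>2)) (q\<^sup>2) * qpoch_inf (- q * q ^ 4) (q ^ 4))
        = qpoch_inf (- (q\<^sup>2)) (q\<^sup>2) * qpoch_inf (- q) (q ^ 4)"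
      using qpoch_inf_shift[OF norm_power_less_one[OF q], of 4 "- q"] by (simp add: mult.left_commute)
    also have "\<dots> = 1 / (mod8_product q 6 * mod8_product q 2) * (mod8_product q 2 / (mod8_product q 1 * mod8_product q 5))"
      unfolding qpoch_inf_minus_q2_q2[OF q] qpoch_inf_minus_q1_q4[OF q] by (simp only: mult.commute)
    also have "\<dots> = 1 / (mod8_product q 6 * mod8_product q 1 * mod8_product q 5)"
      by (rule cancel[OF nz(1)])
    also have "\<dots> = 1 / qpochs_inf [q, q ^ 5, q ^ 6] (q ^ 8)"
      using qpochs_inf_mod8[of q 1 5 6] by (simp only: power_one_right mult_ac)
    finally show ?thesis .
  qed
qed

lemma goellnitz_gordon_sums:
  assumes q: "norm q < 1"
  shows goellnitz_gordon_first: "(\<lambda>n. q ^ (n\<^sup>2) * (qpoch (- q) (q\<^sup>2) n / qpoch (q\<^sup>2) (q\<^sup>2) n)) sums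
            (1 / qpochs_inf [q, q ^ 4, q ^ 7] (q ^ 8))"
    and goellnitz_gordon_second: "(\<lambda>n. q ^ (n\<^sup>2 + 2 * n) * (qpoch (- q) (q\<^sup>2) n / qpoch (q\<^sup>2) (q\<^sup>2) n)) sums
            (1 / qpochs_inf [q ^ 3, q ^ 4, q ^ 5] (q ^ 8))"
proof -
  have nz: "mod8_product q a \<noteq> 0" if "a > 0" for a
    by (rule mod8_product_nonzero[OF q that])
  have cancel: "1 / (x * y) * y = 1 / x" if "y \<noteq> 0" for x y :: complex
    using that by simp
  have "qpoch_inf (- q) (q\<^sup>2) / qpoch_inf (q\<^sup>2) (q\<^sup>2)
      * (mod8_product q 3 * mod8_product q 5 * mod8_product q 8) = 1 / qpochs_inf [q ^ 1, q ^ 4, q ^ 7] (q ^ 8)"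
  proof -
    have "mod8_product q 1 * mod8_product q 3 * mod8_product q 4 * mod8_product q 5 * mod8_product q 7 * mod8_product q 8
       = mod8_product q 1 * mod8_product q 4 * mod8_product q 7 * (mod8_product q 3 * mod8_product q 5 * mod8_product q 8)"
      by (simp only: mult_ac)
    then show ?thesis
      unfolding goellnitz_gordon_prefactor[OF q] qpochs_inf_mod8 by (simp only:) (rule cancel, simp add: nz)
  qed
  then show "(\<lambda>n. q ^ (n\<^sup>2) * (qpoch (- q) (q\<^sup>2) n / qpoch (q\<^sup>2) (q\<^sup>2) n)) sums
            (1 / qpochs_inf [q, q ^ 4, q ^ 7] (q ^ 8))"
    using goellnitz_gordon_sum_0[OF q] by (simp only: mod8_product_def power_one_right)
  have "qpoch_inf (- q) (q\<^sup>2) / qpoch_inf (q\<^sup>2) (q\<^sup>2)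
      * (mod8_product q 7 * mod8_product q 1 * mod8_product q 8) = 1 / qpochs_inf [q ^ 3, q ^ 4, q ^ 5] (q ^ 8)"
  proof -
    have "mod8_product q 1 * mod8_product q 3 * mod8_product q 4 * mod8_product q 5 * mod8_product q 7 * mod8_product q 8
       = mod8_product q 3 * mod8_product q 4 * mod8_product q 5 * (mod8_product q 7 * mod8_product q 1 * mod8_product q 8)"
      by (simp only: mult_ac)
    then show ?thesis
      unfolding goellnitz_gordon_prefactor[OF q] qpochs_inf_mod8 by (simp only:) (rule cancel, simp add: nz)
  qed
  then show "(\<lambda>n. q ^ (n\<^sup>2 + 2 * n) * (qpoch (- q) (q\<^sup>2) n / qpoch (q\<^sup>2) (q\<^sup>2) n)) sums
            (1 / qpochs_inf [q ^ 3, q ^ 4, q ^ 5] (q ^ 8))"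
    using goellnitz_gordon_sum_1[OF q] by (simp only: mod8_product_def power_one_right)
qed

section \<open>The double sums\<close>

lemma double_sum_exponents:
  shows "(3 * i\<^sup>2 - i) div 2 + 4 * i * j + 4 * j\<^sup>2 = (i + 2 * j)\<^sup>2 + triangle (i - 1)"
    and "(3 * i\<^sup>2 + 3 * i) div 2 + 4 * i * j + 4 * j\<^sup>2 + 4 * j = (i + 2 * j)\<^sup>2 + 2 * (i + 2 * j) + triangle (i - 1)"
    and "(3 * i\<^sup>2 + i) div 2 + 4 * i * j + 4 * j\<^sup>2 + 2 * j = (i + 2 * j)\<^sup>2 + (i + 2 * j) + triangle (i - 1)"
proof -
  define t where "t = triangle (i - 1)"
  have i2: "i\<^sup>2 = i + 2 * t"
    unfolding t_def by (rule square_eq_triangle)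
  have N2: "(i + 2 * j)\<^sup>2 = i\<^sup>2 + 4 * i * j + 4 * j\<^sup>2"
    by (simp add: power2_eq_square algebra_simps)
  have "3 * i\<^sup>2 - i = 2 * (i\<^sup>2 + t)" "3 * i\<^sup>2 + 3 * i = 2 * (i\<^sup>2 + 2 * i + t)" "3 * i\<^sup>2 + i = 2 * (i\<^sup>2 + i + t)"
    unfolding i2 by simp_all
  then show "(3 * i\<^sup>2 - i) div 2 + 4 * i * j + 4 * j\<^sup>2 = (i + 2 * j)\<^sup>2 + triangle (i - 1)"
    and "(3 * i\<^sup>2 + 3 * i) div 2 + 4 * i * j + 4 * j\<^sup>2 + 4 * j = (i + 2 * j)\<^sup>2 + 2 * (i + 2 * j) + triangle (i - 1)"
    and "(3 * i\<^sup>2 + i) div 2 + 4 * i * j + 4 * j\<^sup>2 + 2 * j = (i + 2 * j)\<^sup>2 + (i + 2 * j) + triangle (i - 1)"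
    unfolding N2 t_def[symmetric] by simp_all
qed

theorem theorem1p5:
  fixes q :: complex
  assumes "norm q < 1"
  shows "((\<lambda>(i::nat, j::nat). q ^ ((3 * i\<^sup>2 - i) div 2 + 4 * i * j + 4 * j\<^sup>2)
            / (qpoch q q i * qpoch (q ^ 4) (q ^ 4) j))
          has_sum 1 / qpochs_inf [q, q ^ 4, q ^ 7] (q ^ 8)) UNIV
      \<and> ((\<lambda>(i::nat, j::nat). q ^ ((3 * i\<^sup>2 + 3 * i) div 2 + 4 * i * j + 4 * j\<^sup>2 + 4 * j)
            / (qpoch q q i * qpoch (q ^ 4) (q ^ 4) j))
          has_sum 1 / qpochs_inf [q ^ 3, q ^ 4, q ^ 5] (q ^ 8)) UNIV
      \<and> ((\<lambda>(i::nat, j::nat). q ^ ((3 * i\<^sup>2 + i) div 2 + 4 * i * j + 4 * j\<^sup>2 + 2 * j)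
            * (1 + q ^ (2 * i + 4 * j + 1))
            / (qpoch q q i * qpoch (q ^ 4) (q ^ 4) j))
          has_sum 1 / qpochs_inf [q, q ^ 5, q ^ 6] (q ^ 8)) UNIV
      \<and> ((\<lambda>(i::nat, j::nat). q ^ ((3 * i\<^sup>2 + i) div 2 + 4 * i * j + 4 * j\<^sup>2 + 2 * j)
            / (qpoch q q i * qpoch (q ^ 4) (q ^ 4) j))
          has_sum 1 / qpochs_inf [q ^ 2, q ^ 3, q ^ 7] (q ^ 8)) UNIV"
proof (intro conjI)
  note q = assms
  have N_le: "N \<le> N\<^sup>2" for N :: nat
    by (simp add: power2_eq_square)
  have bound: "norm (q ^ e) \<le> 1 * norm q ^ N" if "N \<le> e" for e N
    using norm_power_le_power[OF q that] by simp
  show "((\<lambda>(i::nat, j::nat). q ^ ((3 * i\<^sup>2 - i) div 2 + 4 * i * j + 4 * j\<^sup>2)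
            / (qpoch q q i * qpoch (q ^ 4) (q ^ 4) j))
          has_sum 1 / qpochs_inf [q, q ^ 4, q ^ 7] (q ^ 8)) UNIV"
    using double_sum_eq_single_sum[OF q bound[OF N_le] goellnitz_gordon_first[OF q]]
    unfolding double_sum_exponents power_add by (simp only: times_divide_eq_right)
  show "((\<lambda>(i::nat, j::nat). q ^ ((3 * i\<^sup>2 + 3 * i) div 2 + 4 * i * j + 4 * j\<^sup>2 + 4 * j)
            / (qpoch q q i * qpoch (q ^ 4) (q ^ 4) j))
          has_sum 1 / qpochs_inf [q ^ 3, q ^ 4, q ^ 5] (q ^ 8)) UNIV"
    using double_sum_eq_single_sum[OF q bound[OF trans_le_add1[OF N_le]] goellnitz_gordon_second[OF q]]
    unfolding double_sum_exponents power_add by (simp only: times_divide_eq_right)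
  show "((\<lambda>(i::nat, j::nat). q ^ ((3 * i\<^sup>2 + i) div 2 + 4 * i * j + 4 * j\<^sup>2 + 2 * j)
            * (1 + q ^ (2 * i + 4 * j + 1))
            / (qpoch q q i * qpoch (q ^ 4) (q ^ 4) j))
          has_sum 1 / qpochs_inf [q, q ^ 5, q ^ 6] (q ^ 8)) UNIV"
  proof -
    have "norm (q ^ (N\<^sup>2 + N) * (1 + q ^ (2 * N + 1))) \<le> 2 * norm q ^ N" for N
    proof -
      have "norm (1 + q ^ (2 * N + 1)) \<le> 2"
        using norm_triangle_ineq[of 1 "q ^ (2 * N + 1)"] bound[of 0 "2 * N + 1"] by simp
      then show ?thesis
        unfolding norm_mult using bound[OF trans_le_add1[OF N_le], of N N]
        by (subst mult.commute) (intro mult_mono, auto)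
    qed
    from double_sum_eq_single_sum[OF q this little_goellnitz_first[OF q]]
    have "((\<lambda>(i, j). q ^ ((i + 2 * j)\<^sup>2 + (i + 2 * j)) * (1 + q ^ (2 * (i + 2 * j) + 1))
            * (q ^ triangle (i - 1) / (qpoch q q i * qpoch (q ^ 4) (q ^ 4) j)))
          has_sum 1 / qpochs_inf [q, q ^ 5, q ^ 6] (q ^ 8)) UNIV" .
    moreover have "2 * (i + 2 * j) = 2 * i + 4 * j" for i j :: nat
      by simp
    ultimately show ?thesis
      unfolding double_sum_exponents power_add[of q "_ + _" "triangle _"]
      by (simp only: times_divide_eq_right mult.assoc mult.commute[of "1 + _"])
  qed
  show "((\<lambda>(i::nat, j::nat). q ^ ((3 * i\<^sup>2 + i) div 2 + 4 * i * j + 4 * j\<^sup>2 + 2 * j)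
            / (qpoch q q i * qpoch (q ^ 4) (q ^ 4) j))
          has_sum 1 / qpochs_inf [q ^ 2, q ^ 3, q ^ 7] (q ^ 8)) UNIV"
    using double_sum_eq_single_sum[OF q bound[OF trans_le_add1[OF N_le]] little_goellnitz_second[OF q]]
    unfolding double_sum_exponents power_add by (simp only: times_divide_eq_right)
qed

end
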